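(* Let $\mathbf{H}\in\mathbb{H}^4$. The following are equivalent: (1) $\mathbf{H}$ is monoclinic; (2) $\mathbf{Cov}_2(\mathbf{H})$ is monoclinic; (3) the triple $(\mathbf{d}_2,\mathbf{c}_3,\mathbf{c}_4)$ is monoclinic. In that case the symmetry group of $\mathbf{H}$ equals the symmetry group of $(\mathbf{d}_2,\mathbf{c}_3,\mathbf{c}_4)$.
   Context: $\mathbb{H}^4$ is the space of totally symmetric traceless fourth-order tensors on $\mathbb{R}^3$, with $SO(3)$-action $(g\star\mathbf{T})(x_1,\dots,x_n)=\mathbf{T}(g^{-1}x_1,\dots,g^{-1}x_n)$. $\mathbf{Cov}_2(\mathbf{H})\subset\mathrm{Sym}^2(\mathbb{R}^3)$ is the set of values at $\mathbf{H}$ of all $SO(3)$-equivariant polynomial maps $\mathbb{H}^4\to\mathrm{Sym}^2(\mathbb{R}^3)$. $(\mathbf{H}:\mathbf{H})_{ijkl}=H_{ijmn}H_{mnkl}$, $(\mathbf{H}:\mathbf{a})_{ij}=H_{ijkl}a_{kl}$, $(\operatorname{tr}_{13}\mathbf{A})_{ij}=A_{kikj}$, $\mathbf{d}_2=\operatorname{tr}_{13}(\mathbf{H}:\mathbf{H})$, $\mathbf{c}_3=\mathbf{H}:\mathbf{d}_2$, $\mathbf{c}_4=\mathbf{H}:\mathbf{c}_3$. Symmetry group of a tensor: $\{g\in SO(3):g\star\mathbf{T}=\mathbf{T}\}$; of a family or subspace: intersection; symmetry class: conjugacy class. Monoclinic means class $[\mathbb{Z}_2]$, $\mathbb{Z}_2$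 generated by a rotation by $\pi$. *)

theory Defs
  imports "HOL-Analysis.Analysis"
begin

type_synonym mat3 = "real^3^3"
type_synonym tens4 = "3 \<Rightarrow> 3 \<Rightarrow> 3 \<Rightarrow> 3 \<Rightarrow> real"
type_synonym tens2 = "3 \<Rightarrow> 3 \<Rightarrow> real"

definition SO3 :: "mat3 set" where
  "SO3 = {g. orthogonal_matrix g \<and> det g = 1}"

text \<open>(g * T)(x1,..,xn) = T(g^-1 x1,..,g^-1 xn), written in components (g^-1 = g^T).\<close>
definition act4 :: "mat3 \<Rightarrow> tens4 \<Rightarrow> tens4" where
  "act4 g T = (\<lambda>i j k l. \<Sum>p\<in>UNIV. \<Sum>q\<in>UNIV. \<Sum>r\<in>UNIV. \<Sum>s\<in>UNIV.
      g$i$p * g$j$q * g$k$r * g$l$s * T p q r s)"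

definition act2 :: "mat3 \<Rightarrow> tens2 \<Rightarrow> tens2" where
  "act2 g a = (\<lambda>i j. \<Sum>p\<in>UNIV. \<Sum>q\<in>UNIV. g$i$p * g$j$q * a p q)"

definition Sym2 :: "tens2 set" where
  "Sym2 = {a. \<forall>i j. a i j = a j i}"

definition H4 :: "tens4 set" where
  "H4 = {T. (\<forall>i j k l. T i j k l = T j i k l \<and> T i j k l = T i k j l \<and> T i j k l = T i j l k)
          \<and> (\<forall>k l. (\<Sum>i\<in>UNIV. T i i k l) = 0)}"

inductive_set poly_fun :: "(tens4 \<Rightarrow> real) set" where
  pf_const: "(\<lambda>T. c) \<in> poly_fun"
| pf_coord: "(\<lambda>T. T i j k l) \<in> poly_fun"
| pf_add: "f \<in> poly_fun \<Longrightarrow> h \<in> poly_fun \<Longrightarrow> (\<lambda>T. f T + h T) \<in> poly_fun"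
| pf_mult: "f \<in> poly_fun \<Longrightarrow> h \<in> poly_fun \<Longrightarrow> (\<lambda>T. f T * h T) \<in> poly_fun"

definition equiv_poly_map :: "(tens4 \<Rightarrow> tens2) \<Rightarrow> bool" where
  "equiv_poly_map F \<longleftrightarrow>
     (\<forall>i j. (\<lambda>T. F T i j) \<in> poly_fun) \<and>
     (\<forall>T\<in>H4. F T \<in> Sym2) \<and>
     (\<forall>g\<in>SO3. \<forall>T\<in>H4. F (act4 g T) = act2 g (F T))"

definition Cov2 :: "tens4 \<Rightarrow> tens2 set" where
  "Cov2 H = {F H | F. equiv_poly_map F}"

definition symgrp4 :: "tens4 \<Rightarrow> mat3 set" where
  "symgrp4 T = {g\<in>SO3. act4 g T = T}"

definition symgrp2 :: "tens2 \<Rightarrow> mat3 set" where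
  "symgrp2 a = {g\<in>SO3. act2 g a = a}"

definition symgrp2_set :: "tens2 set \<Rightarrow> mat3 set" where
  "symgrp2_set S = {g\<in>SO3. \<forall>a\<in>S. act2 g a = a}"

definition d2 :: "tens4 \<Rightarrow> tens2" where
  "d2 H = (\<lambda>i j. \<Sum>k\<in>UNIV. \<Sum>m\<in>UNIV. \<Sum>n\<in>UNIV. H k i m n * H m n k j)"

definition contr :: "tens4 \<Rightarrow> tens2 \<Rightarrow> tens2" where
  "contr H a = (\<lambda>i j. \<Sum>k\<in>UNIV. \<Sum>l\<in>UNIV. H i j k l * a k l)"

definition c3 :: "tens4 \<Rightarrow> tens2" where
  "c3 H = contr H (d2 H)"

definition c4 :: "tens4 \<Rightarrow> tens2" where
  "c4 H = contr H (c3 H)"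

definition rot_pi_e3 :: mat3 where
  "rot_pi_e3 = (\<chi> i j. if i = j then (if i = 2 then 1 else -1) else 0)"

definition Z2 :: "mat3 set" where
  "Z2 = {mat 1, rot_pi_e3}"

definition monoclinic :: "mat3 set \<Rightarrow> bool" where
  "monoclinic G \<longleftrightarrow> (\<exists>g\<in>SO3. G = (\<lambda>k. g ** k ** matrix_inv g) ` Z2)"

end

theory Submission
  imports Defs
begin

text \<open>By equivariance one may take the monoclinic axis to be the axis of \<^const>\<open>rot_pi_e3\<close>, and the symmetry
  groups of \<open>H\<close>, \<open>Cov\<^sub>2(H)\<close> and the triple increase in this order.

  Suppose that the half turn fixes the triple but not \<open>H\<close>. The odd part of \<open>H\<close> is then a nonzero binary
  cubic, and contraction with it annihilates \<open>d\<^sub>2\<close> and \<open>c\<^sub>3\<close> (and every covariant fixed by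
  the half turn). If this contraction has rank 2, then modulo the identity all of these are multiples of one
  tensor, and they share a half turn about a second axis. If it has rank 1, the cubic is a cube of
  a linear form, and the off-diagonal entries of \<open>d\<^sub>2\<close> and \<open>c\<^sub>3\<close> force \<open>H\<close> itself to have a second half turn.
  In both cases the larger groups are not of order two.

  Suppose conversely that the half turn fixes \<open>H\<close> and that the triple has a further symmetry. Then
  either \<open>d\<^sub>2\<close> is isotropic in the plane, and \<open>H\<close> is orthotropic or tetragonal, or \<open>d\<^sub>2\<close>, \<open>c\<^sub>3\<close>, \<open>c\<^sub>4\<close> are simultaneously
  diagonal. The latter makes \<open>d\<^sub>2\<close> an eigenvector of contraction with \<open>H\<close> unless \<open>H\<close> is orthotropic, and
  solving the resulting equations shows that \<open>H\<close> is trigonal.\<close>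

section \<open>Equivariance of the covariants\<close>

lemma SO3_mult: "g \<in> SO3 \<Longrightarrow> h \<in> SO3 \<Longrightarrow> g ** h \<in> SO3"
  by (simp add: SO3_def orthogonal_matrix_mul det_mul)

lemma SO3_transpose: "g \<in> SO3 \<Longrightarrow> transpose g \<in> SO3"
  by (simp add: SO3_def orthogonal_matrix_transpose)

lemma SO3_transpose_mult: "g \<in> SO3 \<Longrightarrow> transpose g ** g = mat 1" "g \<in> SO3 \<Longrightarrow> g ** transpose g = mat 1"
  by (simp_all add: SO3_def orthogonal_matrix_def)

lemma SO3_matrix_inv:
  assumes "g \<in> SO3"
  shows "matrix_inv g = transpose g"
proof -
  have "g ** matrix_inv g = mat 1 \<and> matrix_inv g ** g = mat 1"
    unfolding matrix_inv_def
    by (rule someI[where x = "transpose g"]) (simp add: SO3_transpose_mult[OF assms])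
  then show ?thesis
    using SO3_transpose_mult(1)[OF assms] by (metis matrix_mul_assoc matrix_mul_lid matrix_mul_rid)
qed

lemma sum_rotate: "(\<Sum>k\<in>A. \<Sum>m\<in>B. \<Sum>n\<in>C. f k m n) = (\<Sum>m\<in>B. \<Sum>n\<in>C. \<Sum>k\<in>A. f k m n)"
  by (rule trans[OF sum.swap], rule sum.cong[OF refl], rule sum.swap)

lemma SO3_columns:
  assumes "g \<in> SO3"
  shows "(\<Sum>k\<in>UNIV. g$k$p * g$k$q) = (if p = q then 1 else 0)"
proof -
  have "(transpose g ** g)$p$q = (mat 1 :: mat3)$p$q"
    using SO3_transpose_mult(1)[OF assms] by simp
  then show ?thesis by (simp add: matrix_matrix_mult_def transpose_def mat_def)
qed

text \<open>Columns of a rotation are orthonormal, so a rotated index pair may be summed as if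
  unrotated. Equivariance of \<open>contr\<close> and \<open>d2\<close> rests on this.\<close>

lemma SO3_contract:
  assumes "g \<in> SO3"
  shows "(\<Sum>k\<in>UNIV. (\<Sum>p\<in>UNIV. g$k$p * x p) * (\<Sum>q\<in>UNIV. g$k$q * y q)) = (\<Sum>p\<in>UNIV. x p * y p)"
proof -
  have "(\<Sum>k\<in>UNIV. (\<Sum>p\<in>UNIV. g$k$p * x p) * (\<Sum>q\<in>UNIV. g$k$q * y q))
      = (\<Sum>k\<in>UNIV. \<Sum>p\<in>UNIV. \<Sum>q\<in>UNIV. (g$k$p * g$k$q) * (x p * y q))"
    by (simp add: sum_product algebra_simps)
  also have "\<dots> = (\<Sum>p\<in>UNIV. \<Sum>k\<in>UNIV. \<Sum>q\<in>UNIV. (g$k$p * g$k$q) * (x p * y q))"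
    by (rule sum.swap)
  also have "\<dots> = (\<Sum>p\<in>UNIV. \<Sum>q\<in>UNIV. \<Sum>k\<in>UNIV. (g$k$p * g$k$q) * (x p * y q))"
    by (intro sum.cong refl sum.swap)
  also have "\<dots> = (\<Sum>p\<in>UNIV. \<Sum>q\<in>UNIV. (if p = q then 1 else 0) * (x p * y q))"
    unfolding SO3_columns[OF assms, symmetric] by (simp add: sum_distrib_right)
  also have "\<dots> = (\<Sum>p\<in>UNIV. x p * y p)"
    by (simp add: if_distrib[of "\<lambda>c. c * _"] cong: if_cong)
  finally show ?thesis .
qed

section \<open>Actions on tensors of order two and four\<close>

lemma act2_nested: "act2 g a i j = (\<Sum>p\<in>UNIV. g$i$p * (\<Sum>q\<in>UNIV. g$j$q * a p q))"
  by (simp add: act2_def sum_distrib_left mult.assoc)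

lemma act2_nested': "act2 g a i j = (\<Sum>q\<in>UNIV. g$j$q * (\<Sum>p\<in>UNIV. g$i$p * a p q))"
proof -
  have "act2 g a i j = (\<Sum>p\<in>UNIV. \<Sum>q\<in>UNIV. g$j$q * (g$i$p * a p q))"
    by (simp add: act2_def mult.commute mult.left_commute)
  also have "\<dots> = (\<Sum>q\<in>UNIV. \<Sum>p\<in>UNIV. g$j$q * (g$i$p * a p q))"
    by (rule sum.swap)
  finally show ?thesis by (simp add: sum_distrib_left)
qed

lemma act2_act2: "act2 g (act2 h a) = act2 (g ** h) a"
proof (intro ext)
  fix i j
  have *: "(\<Sum>p\<in>UNIV. g$i$p * (\<Sum>q\<in>UNIV. h$p$q * f q)) = (\<Sum>q\<in>UNIV. (g ** h)$i$q * f q)"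
    for f :: "3 \<Rightarrow> real" and i
  proof -
    have "(\<Sum>p\<in>UNIV. g$i$p * (\<Sum>q\<in>UNIV. h$p$q * f q)) = (\<Sum>p\<in>UNIV. \<Sum>q\<in>UNIV. g$i$p * h$p$q * f q)"
      by (simp add: sum_distrib_left mult.assoc)
    also have "\<dots> = (\<Sum>q\<in>UNIV. \<Sum>p\<in>UNIV. g$i$p * h$p$q * f q)"
      by (rule sum.swap)
    finally show ?thesis
      by (simp add: matrix_matrix_mult_def sum_distrib_right)
  qed
  have "act2 g (act2 h a) i j
      = (\<Sum>p\<in>UNIV. g$i$p * (\<Sum>q\<in>UNIV. g$j$q * (\<Sum>s\<in>UNIV. h$q$s * (\<Sum>r\<in>UNIV. h$p$r * a r s))))"
    unfolding act2_nested[of g] act2_nested'[of h] ..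
  also have "\<dots> = (\<Sum>p\<in>UNIV. g$i$p * (\<Sum>s\<in>UNIV. (g ** h)$j$s * (\<Sum>r\<in>UNIV. h$p$r * a r s)))"
    unfolding * ..
  also have "\<dots> = (\<Sum>p\<in>UNIV. g$i$p * (\<Sum>r\<in>UNIV. h$p$r * (\<Sum>s\<in>UNIV. (g ** h)$j$s * a r s)))"
  proof -
    have "(\<Sum>s\<in>UNIV. (g ** h)$j$s * (\<Sum>r\<in>UNIV. h$p$r * a r s))
        = (\<Sum>r\<in>UNIV. h$p$r * (\<Sum>s\<in>UNIV. (g ** h)$j$s * a r s))" for p
      unfolding sum_distrib_left by (subst sum.swap) (simp add: mult.left_commute)
    then show ?thesis by simp
  qed
  also have "\<dots> = act2 (g ** h) a i j"
    unfolding * act2_nested ..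
  finally show "act2 g (act2 h a) i j = act2 (g ** h) a i j" .
qed

lemma act2_mat1 [simp]: "act2 (mat 1) a = a"
  by (intro ext) (simp add: act2_nested mat_def if_distrib[of "\<lambda>c. c * _"] cong: if_cong)

text \<open>Splitting the four indices into two pairs reduces composition, traces and contractions
  to facts about \<open>act2\<close>.\<close>

lemma act4_act2: "act4 g T i j k l = act2 g (\<lambda>p q. act2 g (T p q) k l) i j"
  by (simp add: act4_def act2_def sum_distrib_left mult.assoc)

lemma act2_sum: "act2 g (\<lambda>p q. \<Sum>x\<in>A. f x p q) i j = (\<Sum>x\<in>A. act2 g (f x) i j)"
proof -
  have "act2 g (\<lambda>p q. \<Sum>x\<in>A. f x p q) i j
     = (\<Sum>p\<in>UNIV. \<Sum>q\<in>UNIV. \<Sum>x\<in>A. g$i$p * g$j$q * f x p q)"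
    by (simp add: act2_def sum_distrib_left)
  also have "\<dots> = (\<Sum>p\<in>UNIV. \<Sum>x\<in>A. \<Sum>q\<in>UNIV. g$i$p * g$j$q * f x p q)"
    by (intro sum.cong refl sum.swap)
  also have "\<dots> = (\<Sum>x\<in>A. \<Sum>p\<in>UNIV. \<Sum>q\<in>UNIV. g$i$p * g$j$q * f x p q)"
    by (rule sum.swap)
  finally show ?thesis by (simp add: act2_def)
qed

lemma act2_scale: "act2 g (\<lambda>p q. c * a p q) i j = c * act2 g a i j"
  by (simp add: act2_def sum_distrib_left mult.left_commute)

lemma act2_commute:
  "act2 g (\<lambda>p q. act2 h (\<lambda>r s. F p q r s) k l) i j = act2 h (\<lambda>r s. act2 g (\<lambda>p q. F p q r s) i j) k l"
  unfolding act2_def[of h] act2_sum act2_scale ..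

lemma act4_act4: "act4 g (act4 h T) = act4 (g ** h) T"
proof (intro ext)
  fix i j k l
  have "act4 g (act4 h T) i j k l
     = act2 g (\<lambda>p q. act2 g (\<lambda>r s. act2 h (\<lambda>p' q'. act2 h (T p' q') r s) p q) k l) i j"
    unfolding act4_act2[of g] by (simp add: act4_act2[of h, abs_def])
  also have "\<dots> = act2 g (\<lambda>p q. act2 h (\<lambda>p' q'. act2 g (act2 h (T p' q')) k l) p q) i j"
    by (subst act2_commute) simp
  also have "\<dots> = act4 (g ** h) T i j k l"
    using act2_act2[of g h "\<lambda>p' q'. act2 (g ** h) (T p' q') k l"]
    by (simp add: act2_act2 act4_act2)
  finally show "act4 g (act4 h T) i j k l = act4 (g ** h) T i j k l" .
qed

lemma act4_mat1 [simp]: "act4 (mat 1) T = T"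
  by (intro ext) (simp add: act4_act2)

lemma act2_inner:
  assumes "g \<in> SO3"
  shows "(\<Sum>k\<in>UNIV. \<Sum>l\<in>UNIV. act2 g a k l * act2 g b k l) = (\<Sum>k\<in>UNIV. \<Sum>l\<in>UNIV. a k l * b k l)"
proof -
  have "(\<Sum>k\<in>UNIV. \<Sum>l\<in>UNIV. act2 g a k l * act2 g b k l)
     = (\<Sum>k\<in>UNIV. \<Sum>q\<in>UNIV. (\<Sum>p\<in>UNIV. g$k$p * a p q) * (\<Sum>p\<in>UNIV. g$k$p * b p q))"
    unfolding act2_nested' SO3_contract[OF assms] ..
  also have "\<dots> = (\<Sum>q\<in>UNIV. \<Sum>p\<in>UNIV. a p q * b p q)"
    by (subst sum.swap) (simp add: SO3_contract[OF assms])
  also have "\<dots> = (\<Sum>k\<in>UNIV. \<Sum>l\<in>UNIV. a k l * b k l)"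
    by (rule sum.swap)
  finally show ?thesis .
qed

lemma act2_delta:
  assumes "g \<in> SO3"
  shows "act2 g (\<lambda>i j. if i = j then 1 else 0) = (\<lambda>i j. if i = j then 1 else 0)"
proof (intro ext)
  fix i j
  show "act2 g (\<lambda>i j. if i = j then 1 else 0) i j = (if i = j then 1 else 0)"
    using SO3_columns[OF SO3_transpose[OF assms], of i j]
    by (simp add: act2_def transpose_def if_distrib[of "\<lambda>c. _ * c"] cong: if_cong)
qed

lemma contr_act:
  assumes "g \<in> SO3"
  shows "contr (act4 g T) (act2 g a) = act2 g (contr T a)"
proof (intro ext)
  fix i j
  have "contr (act4 g T) (act2 g a) i j
     = (\<Sum>k\<in>UNIV. \<Sum>l\<in>UNIV. act2 g (\<lambda>p q. act2 g a k l * act2 g (T p q) k l) i j)"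
    by (simp add: contr_def act4_act2 act2_scale mult.commute)
  also have "\<dots> = act2 g (\<lambda>p q. \<Sum>k\<in>UNIV. \<Sum>l\<in>UNIV. act2 g (T p q) k l * act2 g a k l) i j"
    by (simp add: act2_sum mult.commute)
  also have "\<dots> = act2 g (contr T a) i j"
    unfolding act2_inner[OF assms] contr_def ..
  finally show "contr (act4 g T) (act2 g a) i j = act2 g (contr T a) i j" .
qed

lemma H4D:
  assumes "T \<in> H4"
  shows "T i j k l = T j i k l" "T i j k l = T i k j l" "T i j k l = T i j l k"
    "(\<Sum>i\<in>UNIV. T i i k l) = 0"
  using assms unfolding H4_def by blast+

lemma act2_swap: "act2 g a j i = act2 g (\<lambda>p q. a q p) i j"
  unfolding act2_nested[of g a j i] act2_nested'[of g _ i j] ..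

lemma act4_H4:
  assumes g: "g \<in> SO3" and T: "T \<in> H4"
  shows "act4 g T \<in> H4"
  unfolding H4_def
proof (safe)
  note sym = H4D(1-3)[OF T]
  fix i j k l
  show "act4 g T i j k l = act4 g T j i k l"
    unfolding act4_act2 act2_swap[of g _ j i] using sym(1) by presburger
  show "act4 g T i j k l = act4 g T i j l k"
    unfolding act4_act2 act2_swap[of g _ l k] using sym(3) by presburger
  have "act4 g T i j k l = (\<Sum>p\<in>UNIV. \<Sum>r\<in>UNIV. \<Sum>q\<in>UNIV. \<Sum>s\<in>UNIV. g$i$p * g$j$q * g$k$r * g$l$s * T p q r s)"
    unfolding act4_def by (intro sum.cong refl sum.swap)
  also have "\<dots> = act4 g T i k j l"
    unfolding act4_def by (intro sum.cong refl) (simp add: sym(2) mult.commute mult.left_commute)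
  finally show "act4 g T i j k l = act4 g T i k j l" .
next
  fix k l
  have "(\<Sum>i\<in>UNIV. act4 g T i i k l)
      = (\<Sum>i\<in>UNIV. \<Sum>j\<in>UNIV. act2 g (\<lambda>i j. if i = j then 1 else 0) i j * act2 g (\<lambda>p q. act2 g (T p q) k l) i j)"
    by (simp add: act2_delta[OF g] act4_act2 if_distrib[of "\<lambda>c. c * _"] cong: if_cong)
  also have "\<dots> = (\<Sum>i\<in>UNIV. act2 g (T i i) k l)"
    by (simp add: act2_inner[OF g] if_distrib[of "\<lambda>c. c * _"] cong: if_cong)
  also have "\<dots> = act2 g (\<lambda>r s. \<Sum>i\<in>UNIV. T i i r s) k l"
    by (simp add: act2_sum)
  also have "\<dots> = 0"
    by (simp add: H4D(4)[OF T] act2_def)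
  finally show "(\<Sum>i\<in>UNIV. act4 g T i i k l) = 0" .
qed

text \<open>Total symmetry turns \<open>d2\<close> into the Gram matrix of the slices of
  \<open>T\<close>, visibly symmetric and with contracted indices in matching positions.\<close>

lemma d2_alt:
  assumes "T \<in> H4"
  shows "d2 T i j = (\<Sum>k\<in>UNIV. \<Sum>m\<in>UNIV. \<Sum>n\<in>UNIV. T i k m n * T j k m n)"
proof -
  note sym = H4D(1-3)[OF assms]
  have "T k i m n * T m n k j = T i k m n * T j k m n" for k m n
  proof -
    have "T m n k j = T j k m n" using sym by metis
    then show ?thesis using sym(1) by metis
  qed
  then show ?thesis by (simp add: d2_def)
qed

lemma d2_act:
  assumes g: "g \<in> SO3" and T: "T \<in> H4"
  shows "d2 (act4 g T) = act2 g (d2 T)"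
proof (intro ext)
  fix i j
  \<comment> \<open>\<open>x\<close> is \<open>T\<close> rotated in its first index only.
    \<open>SO3_contract\<close> then removes the rotation of the second index and
    \<open>act2_inner\<close> that of the last two; the first indices of both factors recombine into
    \<open>act2\<close>.\<close>
  define x where "x i k m n = (\<Sum>p\<in>UNIV. g$i$p * T p k m n)" for i k m n
  have act: "act4 g T i k m n = (\<Sum>q\<in>UNIV. g$k$q * act2 g (x i q) m n)" for i k m n
  proof -
    have "act2 g (x i q) m n = (\<Sum>p\<in>UNIV. g$i$p * act2 g (T p q) m n)" for q
      unfolding x_def by (simp add: act2_sum act2_scale)
    then show ?thesis by (simp add: act4_act2 act2_nested'[of g _ i k])
  qed
  have "d2 (act4 g T) i j
     = (\<Sum>k\<in>UNIV. \<Sum>m\<in>UNIV. \<Sum>n\<in>UNIV. (\<Sum>q\<in>UNIV. g$k$q * act2 g (x i q) m n) * (\<Sum>q\<in>UNIV. g$k$q * act2 g (x j q) m n))"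
    by (simp add: d2_alt[OF act4_H4[OF g T]] act)
  also have "\<dots> = (\<Sum>m\<in>UNIV. \<Sum>n\<in>UNIV. \<Sum>k\<in>UNIV. (\<Sum>q\<in>UNIV. g$k$q * act2 g (x i q) m n) * (\<Sum>q\<in>UNIV. g$k$q * act2 g (x j q) m n))"
    by (rule sum_rotate)
  also have "\<dots> = (\<Sum>m\<in>UNIV. \<Sum>n\<in>UNIV. \<Sum>k\<in>UNIV. act2 g (x i k) m n * act2 g (x j k) m n)"
    by (simp add: SO3_contract[OF g])
  also have "\<dots> = (\<Sum>k\<in>UNIV. \<Sum>m\<in>UNIV. \<Sum>n\<in>UNIV. act2 g (x i k) m n * act2 g (x j k) m n)"
    by (rule sum_rotate[symmetric])
  also have "\<dots> = (\<Sum>k\<in>UNIV. \<Sum>m\<in>UNIV. \<Sum>n\<in>UNIV. x i k m n * x j k m n)"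
    by (simp add: act2_inner[OF g])
  also have "\<dots> = (\<Sum>k\<in>UNIV. \<Sum>m\<in>UNIV. \<Sum>n\<in>UNIV. act2 g (\<lambda>p q. T p k m n * T q k m n) i j)"
  proof -
    have "x i k m n * x j k m n = act2 g (\<lambda>p q. T p k m n * T q k m n) i j" for k m n
      unfolding x_def act2_def sum_product by (intro sum.cong refl) simp
    then show ?thesis by simp
  qed
  also have "\<dots> = act2 g (d2 T) i j"
    unfolding d2_alt[OF T] by (simp add: act2_sum)
  finally show "d2 (act4 g T) i j = act2 g (d2 T) i j" .
qed

lemma c3_act: "g \<in> SO3 \<Longrightarrow> T \<in> H4 \<Longrightarrow> c3 (act4 g T) = act2 g (c3 T)"
  by (simp add: c3_def d2_act contr_act)

lemma c4_act: "g \<in> SO3 \<Longrightarrow> T \<in> H4 \<Longrightarrow> c4 (act4 g T) = act2 g (c4 T)"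
  by (simp add: c4_def c3_act contr_act)

lemma d2_Sym2: "T \<in> H4 \<Longrightarrow> d2 T \<in> Sym2"
  by (simp add: Sym2_def d2_alt mult.commute)

lemma contr_Sym2: "T \<in> H4 \<Longrightarrow> contr T a \<in> Sym2"
  unfolding Sym2_def contr_def using H4D(1)[of T] by simp

section \<open>Polynomial covariants of order two\<close>

lemma poly_fun_sum:
  assumes "finite A" and "\<And>x. x \<in> A \<Longrightarrow> f x \<in> poly_fun"
  shows "(\<lambda>T. \<Sum>x\<in>A. f x T) \<in> poly_fun"
  using assms
proof (induction A rule: finite_induct)
  case empty
  show ?case using pf_const[of 0] by simp
next
  case (insert x A)
  then have "(\<lambda>T. f x T + (\<Sum>x\<in>A. f x T)) \<in> poly_fun"
    by (intro pf_add) simp_all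
  with insert.hyps show ?case by simp
qed

text \<open>This closes \<open>Cov2\<close> under contraction with the tensor, which leads from
  \<open>d2\<close> to \<open>c3\<close> and \<open>c4\<close>.\<close>

lemma equiv_poly_map_contr:
  assumes "equiv_poly_map F"
  shows "equiv_poly_map (\<lambda>T. contr T (F T))"
  unfolding equiv_poly_map_def
proof (intro conjI allI ballI)
  fix i j
  have "(\<lambda>T. F T k l) \<in> poly_fun" for k l
    using assms by (simp add: equiv_poly_map_def)
  then show "(\<lambda>T. contr T (F T) i j) \<in> poly_fun"
    unfolding contr_def by (intro poly_fun_sum poly_fun.intros) auto
next
  fix T g assume "T \<in> H4" "g \<in> SO3"
  then show "contr (act4 g T) (F (act4 g T)) = act2 g (contr T (F T))"
    using assms by (simp add: equiv_poly_map_def contr_act)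
qed (simp add: contr_Sym2)

lemma equiv_poly_map_d2: "equiv_poly_map d2"
  unfolding equiv_poly_map_def
proof (intro conjI allI ballI)
  fix i j
  show "(\<lambda>T. d2 T i j) \<in> poly_fun"
    unfolding d2_def by (intro poly_fun_sum poly_fun.intros) auto
qed (simp_all add: d2_act d2_Sym2)

lemma Cov2_contr: "a \<in> Cov2 T \<Longrightarrow> contr T a \<in> Cov2 T"
  by (auto simp: Cov2_def dest: equiv_poly_map_contr)

lemma d2_Cov2: "d2 T \<in> Cov2 T"
  using equiv_poly_map_d2 by (auto simp: Cov2_def)

lemma Cov2_Sym2: "T \<in> H4 \<Longrightarrow> Cov2 T \<subseteq> Sym2"
  by (auto simp: Cov2_def equiv_poly_map_def)

lemma Cov2_act:
  assumes "g \<in> SO3" "T \<in> H4"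
  shows "Cov2 (act4 g T) = act2 g ` Cov2 T"
proof -
  have "F (act4 g T) = act2 g (F T)" if "equiv_poly_map F" for F
    using that assms by (simp add: equiv_poly_map_def)
  then show ?thesis unfolding Cov2_def by (auto simp: image_iff) metis+
qed

section \<open>Coordinates adapted to the half turn\<close>

definition diag3 :: "real \<Rightarrow> real \<Rightarrow> real \<Rightarrow> mat3" where
  "diag3 p q r = (\<chi> i j. if i = j then (if i = 1 then p else if i = 2 then q else r) else 0)"

text \<open>The half turn \<open>rot_pi_e3\<close> has axis 2 and invariant plane 1-3; these
  rotations about the same axis commute with it.\<close>

definition plane_rot :: "real \<Rightarrow> real \<Rightarrow> mat3" where
  "plane_rot c s = vector [vector [c, 0, s], vector [0, 1, 0], vector [-s, 0, c]]"

text \<open>For \<open>c\<close> and \<open>s\<close> the cosine and sine of an angle, the half turn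
  about the line in the plane 1-3 at half that angle.\<close>

definition plane_flip :: "real \<Rightarrow> real \<Rightarrow> mat3" where
  "plane_flip c s = vector [vector [c, 0, s], vector [0, -1, 0], vector [s, 0, -c]]"

lemma mat3_eq_iff: "(A :: mat3) = B \<longleftrightarrow> (\<forall>i j. A$i$j = B$i$j)"
  by (simp add: vec_eq_iff)

lemma diag3_nth [simp]: "diag3 p q r $ i $ j = (if i = j then (if i = 1 then p else if i = 2 then q else r) else 0)"
  by (simp add: diag3_def)

lemma rot_pi_e3_diag3: "rot_pi_e3 = diag3 (-1) 1 (-1)"
  by (simp add: mat3_eq_iff rot_pi_e3_def forall_3)

lemma mat3_SO3I:
  assumes "\<And>i j. (\<Sum>k\<in>UNIV. g$k$i * g$k$j) = (if i = j then 1 else 0)" "det g = 1"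
  shows "g \<in> SO3"
proof -
  have "transpose g ** g = mat 1"
    by (simp add: mat3_eq_iff matrix_matrix_mult_def transpose_def mat_def assms(1))
  with assms(2) show ?thesis by (simp add: SO3_def orthogonal_matrix)
qed

lemma diag3_SO3:
  assumes "p^2 = 1" "q^2 = 1" "p * q * r = 1"
  shows "diag3 p q r \<in> SO3"
proof (rule mat3_SO3I)
  have "(p * q * r)^2 = 1" using assms(3) by simp
  then have "r^2 = 1" using assms(1,2) by (simp only: power_mult_distrib mult_1)
  then show "(\<Sum>k\<in>UNIV. diag3 p q r$k$i * diag3 p q r$k$j) = (if i = j then 1 else 0)" for i j
    using assms exhaust_3[of i] exhaust_3[of j] by (auto simp: sum_3 power2_eq_square)
  show "det (diag3 p q r) = 1"
    using assms by (simp add: det_3)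
qed

lemma plane_rot_SO3:
  assumes "c^2 + s^2 = 1"
  shows "plane_rot c s \<in> SO3"
proof (rule mat3_SO3I)
  show "(\<Sum>k\<in>UNIV. plane_rot c s$k$i * plane_rot c s$k$j) = (if i = j then 1 else 0)" for i j
    using assms exhaust_3[of i] exhaust_3[of j]
    by (auto simp: plane_rot_def sum_3 power2_eq_square algebra_simps)
  show "det (plane_rot c s) = 1"
    using assms by (simp add: plane_rot_def det_3 power2_eq_square)
qed

lemma plane_flip_SO3:
  assumes "c^2 + s^2 = 1"
  shows "plane_flip c s \<in> SO3"
proof (rule mat3_SO3I)
  show "(\<Sum>k\<in>UNIV. plane_flip c s$k$i * plane_flip c s$k$j) = (if i = j then 1 else 0)" for i j
    using assms exhaust_3[of i] exhaust_3[of j]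
    by (auto simp: plane_flip_def sum_3 power2_eq_square algebra_simps)
  show "det (plane_flip c s) = 1"
    using assms by (simp add: plane_flip_def det_3 power2_eq_square)
qed

lemma rot_pi_SO3: "rot_pi_e3 \<in> SO3"
  by (simp add: rot_pi_e3_diag3 diag3_SO3)

lemma Z2_entries:
  assumes "g \<in> Z2"
  shows "g$2$2 = 1" "g$1$3 = 0" "g$1$2 = 0" "(g$1$1)^2 = 1"
  using assms by (auto simp: Z2_def rot_pi_e3_def mat_def)

lemma plane_flip_notin_Z2: "plane_flip c s \<notin> Z2"
  using Z2_entries(1)[of "plane_flip c s"] by (auto simp: plane_flip_def)

lemma act4_diag:
  assumes "\<And>i j. g$i$j = (if i = j then e i else 0)"
  shows "act4 g T i j k l = e i * e j * e k * e l * T i j k l"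
  by (simp add: act4_act2 act2_nested assms if_distrib[of "\<lambda>c. c * _"] cong: if_cong)

lemma act2_diag:
  assumes "\<And>i j. g$i$j = (if i = j then e i else 0)"
  shows "act2 g a i j = e i * e j * a i j"
  by (simp add: act2_nested assms if_distrib[of "\<lambda>c. c * _"] cong: if_cong)

lemma act2_rot_pi: "act2 rot_pi_e3 a i j = (if (i = 2) = (j = 2) then a i j else - a i j)"
  by (subst act2_diag[where e = "\<lambda>i. if i = 2 then 1 else -1"]) (auto simp: rot_pi_e3_def)

lemma rot_pi_fixes2_iff:
  "act2 rot_pi_e3 a = a \<longleftrightarrow> a 1 2 = 0 \<and> a 2 1 = 0 \<and> a 2 3 = 0 \<and> a 3 2 = 0"
  by (simp add: fun_eq_iff act2_rot_pi forall_3)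

lemma act4_rot_pi: "act4 rot_pi_e3 T i j k l
    = (if (i = 2) = (j = 2) \<longleftrightarrow> (k = 2) = (l = 2) then T i j k l else - T i j k l)"
  by (subst act4_diag[where e = "\<lambda>i. if i = 2 then 1 else -1"]) (auto simp: rot_pi_e3_def)

text \<open>Nine of the fifteen components with sorted indices are independent. The four with an odd number
  of indices 2 change sign under \<^const>\<open>rot_pi_e3\<close>, whose axis carries the index 2.\<close>

lemma H4_trace:
  assumes "T \<in> H4"
  shows "T 2 2 3 3 = - T 2 2 2 2 - T 1 1 2 2"
    "T 1 1 1 1 = - T 1 1 2 2 - T 1 1 3 3"
    "T 3 3 3 3 = - T 1 1 3 3 + T 2 2 2 2 + T 1 1 2 2"
    "T 1 3 3 3 = - T 1 1 1 3 - T 1 2 2 3"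
    "T 1 2 2 2 = - T 1 1 1 2 - T 1 2 3 3"
    "T 2 2 2 3 = - T 1 1 2 3 - T 2 3 3 3"
proof -
  note sym = H4D(1-3)[OF assms]
  note tr = H4D(4)[OF assms, unfolded sum_3]
  show "T 2 2 3 3 = - T 2 2 2 2 - T 1 1 2 2" using tr[of 2 2] by (simp add: sym)
  moreover show "T 1 1 1 1 = - T 1 1 2 2 - T 1 1 3 3" using tr[of 1 1] by (simp add: sym)
  moreover have "T 3 3 3 3 = - T 1 1 3 3 - T 2 2 3 3" using tr[of 3 3] by (simp add: sym)
  ultimately show "T 3 3 3 3 = - T 1 1 3 3 + T 2 2 2 2 + T 1 1 2 2" by simp
  show "T 1 3 3 3 = - T 1 1 1 3 - T 1 2 2 3" using tr[of 1 3] by (simp add: sym)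
  show "T 1 2 2 2 = - T 1 1 1 2 - T 1 2 3 3" using tr[of 1 2] by (simp add: sym)
  show "T 2 2 2 3 = - T 1 1 2 3 - T 2 3 3 3" using tr[of 2 3] by (simp add: sym)
qed

lemma H4_eqI:
  assumes "S \<in> H4" "T \<in> H4"
    and "S 1 1 1 2 = T 1 1 1 2" "S 1 1 2 3 = T 1 1 2 3" "S 1 2 3 3 = T 1 2 3 3" "S 2 3 3 3 = T 2 3 3 3"
    and "S 2 2 2 2 = T 2 2 2 2" "S 1 1 2 2 = T 1 1 2 2" "S 1 1 3 3 = T 1 1 3 3"
    and "S 1 1 1 3 = T 1 1 1 3" "S 1 2 2 3 = T 1 2 2 3"
  shows "S = T"
proof (intro ext)
  fix i j k l
  note sym = H4D(1-3)[OF assms(1)] H4D(1-3)[OF assms(2)]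
  note tr = H4_trace[OF assms(1)] H4_trace[OF assms(2)]
  show "S i j k l = T i j k l"
    using exhaust_3[of i] exhaust_3[of j] exhaust_3[of k] exhaust_3[of l]
    by (elim disjE) (simp_all add: sym tr assms(3-))
qed

lemma rot_pi_fixes4_iff:
  assumes "T \<in> H4"
  shows "act4 rot_pi_e3 T = T \<longleftrightarrow> T 1 1 1 2 = 0 \<and> T 1 1 2 3 = 0 \<and> T 1 2 3 3 = 0 \<and> T 2 3 3 3 = 0"
    (is "?L \<longleftrightarrow> ?R")
proof
  assume ?L
  then have "act4 rot_pi_e3 T i j k l = T i j k l" for i j k l by simp
  from this[of 1 1 1 2] this[of 1 1 2 3] this[of 1 2 3 3] this[of 2 3 3 3] show ?R
    by (simp add: act4_rot_pi)
next
  assume ?R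
  then show ?L
    by (intro H4_eqI act4_H4 rot_pi_SO3 assms) (simp_all add: act4_rot_pi)
qed

text \<open>Conjugation by an \<open>r\<close> that commutes with the half turn fixes both elements
  of \<open>Z2\<close>, so extra symmetries can be carried into and out of a rotated frame.\<close>

lemma conj_notin_Z2:
  assumes r: "r \<in> SO3" "r ** rot_pi_e3 = rot_pi_e3 ** r" and g: "g \<in> SO3 - Z2"
  shows "transpose r ** g ** r \<in> SO3 - Z2" "r ** g ** transpose r \<in> SO3 - Z2"
proof -
  note inv = SO3_transpose_mult[OF r(1)]
  have eq: "g = r ** (transpose r ** g ** r) ** transpose r" "g = transpose r ** (r ** g ** transpose r) ** r"
    using inv by (metis matrix_mul_assoc matrix_mul_lid matrix_mul_rid)+
  have "r ** mat 1 ** transpose r = mat 1" "transpose r ** mat 1 ** r = mat 1"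
    "r ** rot_pi_e3 ** transpose r = rot_pi_e3" "transpose r ** rot_pi_e3 ** r = rot_pi_e3"
    using inv r(2) by (metis matrix_mul_assoc matrix_mul_lid matrix_mul_rid)+
  then have "h \<in> Z2 \<Longrightarrow> r ** h ** transpose r \<in> Z2" "h \<in> Z2 \<Longrightarrow> transpose r ** h ** r \<in> Z2" for h
    unfolding Z2_def by auto
  with eq g have "transpose r ** g ** r \<notin> Z2" "r ** g ** transpose r \<notin> Z2"
    by (metis Diff_iff)+
  then show "transpose r ** g ** r \<in> SO3 - Z2" "r ** g ** transpose r \<in> SO3 - Z2"
    using g r(1) by (simp_all add: SO3_mult SO3_transpose)
qed

lemma plane_rot_commute: "plane_rot c s ** rot_pi_e3 = rot_pi_e3 ** plane_rot c s"
  by (simp add: mat3_eq_iff forall_3 matrix_matrix_mult_def sum_3 plane_rot_def rot_pi_e3_def)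

lemma act4_conj:
  assumes r: "r \<in> SO3" and "act4 g (act4 r T) = act4 r T"
  shows "act4 (transpose r ** g ** r) T = T"
proof -
  have "act4 (transpose r ** g ** r) T = act4 (transpose r) (act4 g (act4 r T))"
    by (simp add: act4_act4 matrix_mul_assoc)
  also have "\<dots> = act4 (transpose r ** r) T"
    by (simp only: assms(2)) (simp only: act4_act4)
  finally show ?thesis by (simp add: SO3_transpose_mult[OF r])
qed

lemma act2_conj:
  assumes r: "r \<in> SO3" and "act2 g a = a"
  shows "act2 (r ** g ** transpose r) (act2 r a) = act2 r a"
proof -
  have "act2 (r ** g ** transpose r) (act2 r a) = act2 (r ** g ** (transpose r ** r)) a"
    by (simp add: act2_act2 matrix_mul_assoc)
  also have "\<dots> = act2 r (act2 g a)"
    by (simp add: SO3_transpose_mult[OF r] act2_act2)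
  finally show ?thesis by (simp add: assms(2))
qed

lemma planar_angle:
  fixes x y :: real
  obtains c s where "c^2 + s^2 = 1" "s * x = c * y"
proof (cases "x = 0 \<and> y = 0")
  case True
  then show ?thesis using that[of 1 0] by simp
next
  case False
  then have pos: "x^2 + y^2 > 0" by (simp add: sum_power2_gt_zero_iff)
  define n where "n = sqrt (x^2 + y^2)"
  have "n^2 = x^2 + y^2" "n \<noteq> 0" using pos by (auto simp: n_def)
  then have "(x/n)^2 + (y/n)^2 = 1" by (metis add_divide_distrib power_divide divide_self power_not_zero)
  then show ?thesis using that[of "x/n" "y/n"] by simp
qed

text \<open>The off-diagonal entry depends on the doubled angle, so the angle of the unit vector
  from \<open>planar_angle\<close> is halved.\<close>

lemma plane_rot_diagonalise:
  assumes "a 3 1 = a 1 3"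
  obtains c s where "c^2 + s^2 = 1" "act2 (plane_rot c s) a 1 3 = 0"
proof -
  obtain C S where cs: "C^2 + S^2 = 1" "S * (a 1 1 - a 3 3) = C * (2 * a 1 3)"
    by (rule planar_angle)
  then obtain t where t: "C = cos t" "S = sin t" using sincos_total_2pi by blast
  define c s where "c = cos (t / 2)" and "s = sin (t / 2)"
  have CS: "C = c^2 - s^2" "S = 2 * s * c"
    using cos_double[of "t/2"] sin_double[of "t/2"] by (simp_all add: t c_def s_def)
  have "act2 (plane_rot c s) a 1 3 = (c^2 - s^2) * a 1 3 - s * c * (a 1 1 - a 3 3)"
    using assms by (simp add: act2_def sum_3 plane_rot_def algebra_simps power2_eq_square)
  moreover have "c^2 + s^2 = 1" by (simp add: c_def s_def)
  ultimately show ?thesis using that[of c s] cs(2) CS by simp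
qed

section \<open>Tensors fixed by the half turn\<close>

text \<open>The assumptions remove the part of weight 2 about the axis 2; the weights 0 and 4 that
  remain are invariant under the quarter turn \<open>plane_rot 0 1\<close>.\<close>

lemma tetragonal_fixed:
  assumes "T \<in> H4" "act4 rot_pi_e3 T = T" "T 1 2 2 3 = 0" "2 * T 1 1 2 2 = - T 2 2 2 2"
  shows "act4 (plane_rot 0 1) T = T"
proof -
  note e = assms(2)[unfolded rot_pi_fixes4_iff[OF assms(1)]]
  note sym = H4D(1-3)[OF assms(1)]
  note tr = H4_trace[OF assms(1)]
  show ?thesis
    by (intro H4_eqI act4_H4 plane_rot_SO3 assms(1))
      (use assms(3,4) e in \<open>simp_all add: act4_def sum_3 plane_rot_def sym tr\<close>)
qed

text \<open>No nonzero component with an odd number of indices 1 is left, and these are the ones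
  that the half turn about the axis 1 reverses.\<close>

lemma orthotropic_fixed:
  assumes "T \<in> H4" "act4 rot_pi_e3 T = T" "T 1 2 2 3 = 0" "T 1 1 1 3 = 0"
  shows "act4 (diag3 1 (-1) (-1)) T = T"
proof -
  note e = assms(2)[unfolded rot_pi_fixes4_iff[OF assms(1)]]
  have "act4 (diag3 1 (-1) (-1)) T i j k l =
    (if i = 1 then 1 else - 1) * (if j = 1 then 1 else - 1) * (if k = 1 then 1 else - 1) * (if l = 1 then 1 else - 1) * T i j k l"
    for i j k l by (rule act4_diag) simp
  then show ?thesis
    by (intro H4_eqI act4_H4 diag3_SO3 assms(1)) (use assms(3,4) e in simp_all)
qed

text \<open>A third of a turn about the axis 1; \<open>rot3_3\<close> is its analogue for the axis
  3.\<close>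

definition rot3_1 :: mat3 where
  "rot3_1 = vector [vector [1, 0, 0], vector [0, -1/2, - sqrt 3 / 2], vector [0, sqrt 3 / 2, -1/2]]"

definition rot3_3 :: mat3 where
  "rot3_3 = vector [vector [-1/2, - sqrt 3 / 2, 0], vector [sqrt 3 / 2, -1/2, 0], vector [0, 0, 1]]"

lemma rot3_SO3: "rot3_1 \<in> SO3" "rot3_3 \<in> SO3"
proof -
  have "(\<Sum>k\<in>UNIV. rot3_1$k$i * rot3_1$k$j) = (if i = j then 1 else 0)"
    "(\<Sum>k\<in>UNIV. rot3_3$k$i * rot3_3$k$j) = (if i = j then 1 else 0)" for i j
    using exhaust_3[of i] exhaust_3[of j] by (auto simp: rot3_1_def rot3_3_def sum_3)
  moreover have "det rot3_1 = 1" "det rot3_3 = 1" by (simp_all add: rot3_1_def rot3_3_def det_3)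
  ultimately show "rot3_1 \<in> SO3" "rot3_3 \<in> SO3" by (auto intro: mat3_SO3I)
qed

text \<open>The two ratios are those of a tensor axisymmetric about the axis 1; the remaining
  parameter \<open>T 1 2 2 3\<close> has weight 3 about that axis.\<close>

lemma trigonal_fixed_1:
  assumes "T \<in> H4" "act4 rot_pi_e3 T = T" "T 1 1 1 3 = 0"
    "3 * T 1 1 2 2 = - 4 * T 2 2 2 2" "3 * T 1 1 3 3 = - 4 * T 2 2 2 2"
  shows "act4 rot3_1 T = T"
proof -
  note e = assms(2)[unfolded rot_pi_fixes4_iff[OF assms(1)]]
  note sym = H4D(1-3)[OF assms(1)]
  note tr = H4_trace[OF assms(1)]
  have p: "T 1 1 2 2 = - 4 / 3 * T 2 2 2 2" "T 1 1 3 3 = - 4 / 3 * T 2 2 2 2" using assms by simp_all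
  have sq: "sqrt 3 * (sqrt 3 * x) = 3 * x" for x by (simp flip: mult.assoc)
  show ?thesis
    by (intro H4_eqI act4_H4 rot3_SO3 assms(1))
      (use e in \<open>simp_all add: act4_def sum_3 rot3_1_def sym tr p assms(3)\<close>, simp_all add: algebra_simps sq)
qed

lemma trigonal_fixed_3:
  assumes "T \<in> H4" "act4 rot_pi_e3 T = T" "T 1 1 1 3 = - T 1 2 2 3"
    "3 * T 1 1 2 2 = T 2 2 2 2" "3 * T 1 1 3 3 = - 4 * T 2 2 2 2"
  shows "act4 rot3_3 T = T"
proof -
  note e = assms(2)[unfolded rot_pi_fixes4_iff[OF assms(1)]]
  note sym = H4D(1-3)[OF assms(1)]
  note tr = H4_trace[OF assms(1)]
  have p: "T 1 1 2 2 = 1 / 3 * T 2 2 2 2" "T 1 1 3 3 = - 4 / 3 * T 2 2 2 2" using assms by simp_all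
  have sq: "sqrt 3 * (sqrt 3 * x) = 3 * x" for x by (simp flip: mult.assoc)
  show ?thesis
    by (intro H4_eqI act4_H4 rot3_SO3 assms(1))
      (use e in \<open>simp_all add: act4_def sum_3 rot3_3_def sym tr p assms(3)\<close>, simp_all add: algebra_simps sq)
qed

text \<open>The factors are the conditions of \<open>orthotropic_fixed\<close> and
  \<open>tetragonal_fixed\<close>, so a vanishing entry gives one of the two.\<close>

lemma d2_even_13:
  assumes "T \<in> H4" "act4 rot_pi_e3 T = T" "T 1 2 2 3 = 0"
  shows "d2 T 1 3 = - T 1 1 1 3 * (2 * T 1 1 2 2 + T 2 2 2 2)"
proof -
  note e = assms(2)[unfolded rot_pi_fixes4_iff[OF assms(1)]]
  note sym = H4D(1-3)[OF assms(1)]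
  note tr = H4_trace[OF assms(1)]
  show ?thesis
    using e assms(3) by (simp add: d2_alt[OF assms(1)] sum_3 sym tr algebra_simps)
qed


text \<open>Here \<open>h\<close>, \<open>u + \<i> v\<close> and \<open>w + \<i> y\<close> are the weight 0, 2 and 4 parts of \<open>T\<close> under rotations
  about the axis 2.\<close>

lemma even_d2_contr:
  assumes T: "T \<in> H4" "act4 rot_pi_e3 T = T"
  defines "h \<equiv> T 2 2 2 2" and "v \<equiv> T 1 2 2 3"
  defines "u \<equiv> T 1 1 2 2 + h / 2" and "w \<equiv> h / 8 - T 1 1 3 3" and "y \<equiv> T 1 1 1 3 + v / 2"
  shows "d2 T 1 3 = - 15/4 * h * v - 2 * (y * u - w * v)"
    and "(d2 T 1 1 - d2 T 3 3) / 2 = - 15/4 * h * u - 2 * (w * u + y * v)"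
    and "(d2 T 1 1 + d2 T 3 3) / 2 - d2 T 2 2 = - 25/16 * h^2 + 4 * w^2 + 4 * y^2 - 2 * (u^2 + v^2)"
    and "\<And>a. a 1 2 = 0 \<Longrightarrow> a 2 1 = 0 \<Longrightarrow> a 2 3 = 0 \<Longrightarrow> a 3 2 = 0 \<Longrightarrow> a 1 3 = 0 \<Longrightarrow> a 3 1 = 0 \<Longrightarrow>
      contr T a 1 3 = - v * ((a 1 1 + a 3 3) / 2 - a 2 2) + 2 * y * ((a 1 1 - a 3 3) / 2)"
    and "\<And>a. a 1 2 = 0 \<Longrightarrow> a 2 1 = 0 \<Longrightarrow> a 2 3 = 0 \<Longrightarrow> a 3 2 = 0 \<Longrightarrow> a 1 3 = 0 \<Longrightarrow> a 3 1 = 0 \<Longrightarrow>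
      (contr T a 1 1 - contr T a 3 3) / 2 = - u * ((a 1 1 + a 3 3) / 2 - a 2 2) + (h / 4 + 2 * w) * ((a 1 1 - a 3 3) / 2)"
    and "\<And>a. a 1 2 = 0 \<Longrightarrow> a 2 1 = 0 \<Longrightarrow> a 2 3 = 0 \<Longrightarrow> a 3 2 = 0 \<Longrightarrow> a 1 3 = 0 \<Longrightarrow> a 3 1 = 0 \<Longrightarrow>
      (contr T a 1 1 + contr T a 3 3) / 2 - contr T a 2 2 = 3/2 * h * ((a 1 1 + a 3 3) / 2 - a 2 2) - 3 * u * ((a 1 1 - a 3 3) / 2)"
proof -
  note e = T(2)[unfolded rot_pi_fixes4_iff[OF T(1)]]
  note sym = H4D(1-3)[OF T(1)]
  note tr = H4_trace[OF T(1)]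
  have p: "T 1 1 2 2 = u - h / 2" "T 1 1 3 3 = h / 8 - w" "T 1 1 1 3 = y - v / 2"
    by (simp_all add: u_def w_def y_def)
  note hv = h_def[symmetric] v_def[symmetric]
  show "d2 T 1 3 = - 15/4 * h * v - 2 * (y * u - w * v)"
    using e by (simp add: d2_alt[OF T(1)] sum_3 sym tr p hv, simp add: field_simps)
  show "(d2 T 1 1 - d2 T 3 3) / 2 = - 15/4 * h * u - 2 * (w * u + y * v)"
    using e by (simp add: d2_alt[OF T(1)] sum_3 sym tr p hv, simp add: field_simps power2_eq_square)
  show "(d2 T 1 1 + d2 T 3 3) / 2 - d2 T 2 2 = - 25/16 * h^2 + 4 * w^2 + 4 * y^2 - 2 * (u^2 + v^2)"
    using e by (simp add: d2_alt[OF T(1)] sum_3 sym tr p hv, simp add: field_simps power2_eq_square)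
  fix a :: tens2 assume a: "a 1 2 = 0" "a 2 1 = 0" "a 2 3 = 0" "a 3 2 = 0" "a 1 3 = 0" "a 3 1 = 0"
  show "contr T a 1 3 = - v * ((a 1 1 + a 3 3) / 2 - a 2 2) + 2 * y * ((a 1 1 - a 3 3) / 2)"
    using e by (simp add: contr_def sum_3 sym tr p hv a, simp add: field_simps)
  show "(contr T a 1 1 - contr T a 3 3) / 2 = - u * ((a 1 1 + a 3 3) / 2 - a 2 2) + (h / 4 + 2 * w) * ((a 1 1 - a 3 3) / 2)"
    using e by (simp add: contr_def sum_3 sym tr p hv a, simp add: field_simps)
  show "(contr T a 1 1 + contr T a 3 3) / 2 - contr T a 2 2 = 3/2 * h * ((a 1 1 + a 3 3) / 2 - a 2 2) - 3 * u * ((a 1 1 - a 3 3) / 2)"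
    using e by (simp add: contr_def sum_3 sym tr p hv a, simp add: field_simps)
qed

text \<open>The solutions are trigonal tensors whose threefold axis is the coordinate axis 1 or 3,
  the axis 2 being one of their twofold axes.\<close>

lemma trigonal_system:
  fixes h u v w y d a :: real
  assumes "v \<noteq> 0" "d \<noteq> 0"
    and d: "d = - 15/4 * h * u - 2 * (w * u + y * v)"
    and a: "a = - 25/16 * h^2 + 4 * w^2 + 4 * y^2 - 2 * (u^2 + v^2)"
    and eqs: "- 15/4 * h * v - 2 * (y * u - w * v) = 0" "- v * a + 2 * y * d = 0"
      "- v * (3/2 * h * a - 3 * u * d) + 2 * y * (- u * a + (h / 4 + 2 * w) * d) = 0"
  shows "24 * w = 35 * h \<and> (6 * u = - 5 * h \<and> 2 * y = v \<or> 6 * u = 5 * h \<and> 2 * y = - v)"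
proof -
  \<comment> \<open>The second equation becomes \<open>a = k * d\<close>; the other two then express
    \<open>u\<close> and \<open>w\<close> through \<open>h\<close> and \<open>k\<close>.\<close>
  define k where "k = 2 * y / v"
  have y: "2 * y = k * v" using \<open>v \<noteq> 0\<close> by (simp add: k_def)
  have "v * (a - k * d) = 0" using eqs(2) y by (auto simp: algebra_simps)
  then have ak: "a = k * d" using \<open>v \<noteq> 0\<close> by simp
  have "v * (15/4 * h + k * u - 2 * w) = 0" using eqs(1) y by (simp add: algebra_simps)
  then have w: "2 * w = 15/4 * h + k * u" using \<open>v \<noteq> 0\<close> by simp
  have "v * d * (3/2 * h * k - 3 * u - k * (h / 4 + 2 * w - u * k)) = 0"
  proof -
    have "- v * (3/2 * h * a - 3 * u * d) + k * v * (- u * a + (h / 4 + 2 * w) * d) = 0" using eqs(3) y by simp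
    then show ?thesis unfolding ak by (simp add: algebra_simps)
  qed
  then have "3/2 * h * k - 3 * u - k * (h / 4 + 2 * w - u * k) = 0" using assms(1,2) by simp
  then have u: "u = - 5/6 * h * k" unfolding w by (simp add: algebra_simps)
  have w': "w = 15/8 * h - 5/12 * h * k^2" using w u by (simp add: power2_eq_square field_simps)
  have y': "y = k * v / 2" using y by simp
  have d': "d = k * (25/4 * h^2 - 25/36 * h^2 * k^2 - v^2)"
    unfolding d u w' y' by (simp add: field_simps power2_eq_square)
  \<comment> \<open>Comparing the formula for \<open>a\<close> with \<open>k * d\<close> leaves this
    product, whose second factor would make \<open>d\<close> zero if it vanished. For
    \<open>a\<close> and \<open>d\<close> taken from a diagonal \<open>d2\<close>,
    \<open>k^2 = 1\<close> means that the entry at the axis 2 equals another diagonal entry.\<close>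
  have "(k^2 - 1) * (2 * v^2 + h^2 * (25/18 * k^2 - 25/2)) = a - k * d"
    unfolding a d' u w' y' by (simp add: field_simps power2_eq_square)
  then have "(k^2 - 1) * (2 * v^2 + h^2 * (25/18 * k^2 - 25/2)) = 0" using ak by simp
  moreover have "2 * v^2 + h^2 * (25/18 * k^2 - 25/2) \<noteq> 0"
  proof
    assume "2 * v^2 + h^2 * (25/18 * k^2 - 25/2) = 0"
    then have "25/4 * h^2 - 25/36 * h^2 * k^2 - v^2 = 0" by (simp add: algebra_simps)
    then show False using d' \<open>d \<noteq> 0\<close> by simp
  qed
  ultimately have k2: "k^2 = 1" by simp
  then have "k = 1 \<or> k = -1" by (simp add: power2_eq_1_iff)
  then show ?thesis using u y w' k2 by auto
qed

section \<open>Common symmetries of second-order tensors\<close>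

lemma act2_fixed_commute:
  assumes g: "g \<in> SO3" and a: "act2 g a = a"
  shows "(\<Sum>p\<in>UNIV. g$i$p * a p j) = (\<Sum>q\<in>UNIV. a i q * g$q$j)"
proof -
  have "(\<Sum>q\<in>UNIV. a i q * g$q$j) = (\<Sum>q\<in>UNIV. act2 g a i q * g$q$j)"
    by (simp add: a)
  also have "\<dots> = (\<Sum>q\<in>UNIV. (\<Sum>r\<in>UNIV. g$q$r * (\<Sum>p\<in>UNIV. g$i$p * a p r)) * (\<Sum>r\<in>UNIV. g$q$r * (if r = j then 1 else 0)))"
    by (simp add: act2_nested' if_distrib[of "\<lambda>c. _ * c"] cong: if_cong)
  also have "\<dots> = (\<Sum>p\<in>UNIV. g$i$p * a p j)"
    unfolding SO3_contract[OF g] by (simp add: if_distrib[of "\<lambda>c. _ * c"] cong: if_cong)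
  finally show ?thesis by simp
qed

lemma diagonal_SO3_in_Z2:
  assumes g: "g \<in> SO3" and off: "g$1$2 = 0" "g$2$1 = 0" "g$1$3 = 0" "g$3$1 = 0" "g$2$3 = 0" "g$3$2 = 0"
    and eq: "g$1$1 = g$3$3"
  shows "g \<in> Z2"
proof -
  have "(g$1$1)^2 = 1" using SO3_columns[OF g, of 1 1] off by (simp add: sum_3 power2_eq_square)
  moreover have "det g = 1" using g by (simp add: SO3_def)
  then have "g$1$1 * g$1$1 * g$2$2 = 1" using off eq by (simp add: det_3 ac_simps)
  ultimately have "g$2$2 = 1" "g$1$1 = 1 \<or> g$1$1 = -1"
    by (auto simp: power2_eq_1_iff)
  then have "g = mat 1 \<or> g = rot_pi_e3"
    using off eq by (auto simp: mat3_eq_iff forall_3 mat_def rot_pi_e3_def)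
  then show ?thesis by (simp add: Z2_def)
qed

text \<open>Otherwise \<open>c\<close> and \<open>d\<close> share no eigenvector in the plane 1-3,
  and a rotation commuting with both is diagonal with equal planar entries, hence in
  \<open>Z2\<close>.\<close>

lemma commutant_planar_diagonal:
  assumes g: "g \<in> SO3 - Z2"
    and d: "act2 rot_pi_e3 d = d" "d 1 3 = 0" "d 3 1 = 0" "d 1 1 \<noteq> d 3 3" "act2 g d = d"
    and c: "act2 rot_pi_e3 c = c" "c 3 1 = c 1 3" "act2 g c = c"
  shows "c 1 3 = 0"
proof (rule ccontr)
  assume nz: "c 1 3 \<noteq> 0"
  have gS: "g \<in> SO3" using g by simp
  note d0 = d(1)[unfolded rot_pi_fixes2_iff] and c0 = c(1)[unfolded rot_pi_fixes2_iff]
  note dc = act2_fixed_commute[OF gS d(5), unfolded sum_3]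
  note cc = act2_fixed_commute[OF gS c(3), unfolded sum_3]
  have 13: "g$1$3 = 0" "g$3$1 = 0" using dc[of 1 3] dc[of 3 1] d0 d(2-4) by (auto simp: ac_simps)
  have 12: "g$1$2 * (d 2 2 - d 1 1) = 0" "g$2$1 * (d 2 2 - d 1 1) = 0"
    using dc[of 1 2] dc[of 2 1] d0 d(2-4) by (auto simp: algebra_simps)
  have 23: "g$2$3 * (d 2 2 - d 3 3) = 0" "g$3$2 * (d 2 2 - d 3 3) = 0"
    using dc[of 2 3] dc[of 3 2] d0 d(2-4) by (auto simp: algebra_simps)
  have e: "g$1$1 = g$3$3" using cc[of 1 3] 13 c0 nz by (simp add: ac_simps)
  have f: "g$2$1 * c 1 3 + g$2$3 * c 3 3 = c 2 2 * g$2$3" "g$1$2 * c 2 2 = c 1 1 * g$1$2 + c 1 3 * g$3$2"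
    "g$2$1 * c 1 1 + g$2$3 * c 1 3 = c 2 2 * g$2$1" "g$3$2 * c 2 2 = c 1 3 * g$1$2 + c 3 3 * g$3$2"
    using cc[of 2 3] cc[of 1 2] cc[of 2 1] cc[of 3 2] c0 c(2) by auto
  have "g$1$2 = 0 \<and> g$2$1 = 0 \<and> g$2$3 = 0 \<and> g$3$2 = 0"
  \<comment> \<open>Since \<open>d 2 2\<close> equals at most one planar entry, commuting with
    \<open>d\<close> clears one mixed pair of entries of \<open>g\<close>; a nonzero
    \<open>c 1 3\<close> then clears the other.\<close>
  proof (cases "d 2 2 = d 1 1")
    case True
    then have "g$2$3 = 0" "g$3$2 = 0" using 23 d(4) by auto
    then show ?thesis using f nz by auto
  next
    case False
    then have "g$1$2 = 0" "g$2$1 = 0" using 12 by auto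
    then show ?thesis using f nz by auto
  qed
  then have "g \<in> Z2" using diagonal_SO3_in_Z2[OF gS] 13 e by blast
  then show False using g by simp
qed

lemma covariants_fixed:
  assumes "T \<in> H4" "g \<in> SO3" "act4 g T = T"
  shows "act2 g (d2 T) = d2 T" "act2 g (c3 T) = c3 T" "act2 g (c4 T) = c4 T"
  using d2_act[of g T] c3_act[of g T] c4_act[of g T] assms by simp_all

lemma Sym2D: "a \<in> Sym2 \<Longrightarrow> a i j = a j i"
  by (simp add: Sym2_def)

lemma c3_Sym2: "T \<in> H4 \<Longrightarrow> c3 T \<in> Sym2" and c4_Sym2: "T \<in> H4 \<Longrightarrow> c4 T \<in> Sym2"
  by (simp_all add: c3_def c4_def contr_Sym2)

lemma SO3_diff_Z2I:
  "c^2 + s^2 = 1 \<Longrightarrow> s \<noteq> 0 \<Longrightarrow> plane_rot c s \<in> SO3 - Z2"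
  "diag3 1 (-1) (-1) \<in> SO3 - Z2" "diag3 (-1) (-1) 1 \<in> SO3 - Z2" "rot3_1 \<in> SO3 - Z2" "rot3_3 \<in> SO3 - Z2"
  using Z2_entries[of "plane_rot c s"] Z2_entries(1)[of "diag3 1 (-1) (-1)"] Z2_entries(1)[of "diag3 (-1) (-1) 1"]
    Z2_entries(1)[of rot3_1] Z2_entries(1)[of rot3_3]
  by (auto simp: plane_rot_SO3 diag3_SO3 rot3_SO3) (auto simp: plane_rot_def rot3_1_def rot3_3_def)

text \<open>The extra symmetry makes \<open>c3 T\<close> and \<open>c4 T\<close> diagonal as well.
  The three vanishing off-diagonal entries are equations in the weight coordinates whose solutions
  are orthotropic or trigonal.\<close>

lemma extra_symmetry_diagonal_frame:
  assumes T: "T \<in> H4" "act4 rot_pi_e3 T = T"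
    and g: "g \<in> SO3 - Z2" "act2 g (d2 T) = d2 T" "act2 g (c3 T) = c3 T" "act2 g (c4 T) = c4 T"
    and d: "d2 T 1 3 = 0" "d2 T 1 1 \<noteq> d2 T 3 3"
  shows "\<exists>g\<in>SO3 - Z2. act4 g T = T"
proof -
  note even = covariants_fixed[OF T(1) rot_pi_SO3 T(2)]
  have ev: "d2 T 1 2 = 0" "d2 T 2 1 = 0" "d2 T 2 3 = 0" "d2 T 3 2 = 0"
      "c3 T 1 2 = 0" "c3 T 2 1 = 0" "c3 T 2 3 = 0" "c3 T 3 2 = 0"
    using even(1,2) by (simp_all add: rot_pi_fixes2_iff)
  have 31: "d2 T 3 1 = 0" "c3 T 3 1 = c3 T 1 3" "c4 T 3 1 = c4 T 1 3"
    using Sym2D[OF d2_Sym2[OF T(1)], of 3 1] Sym2D[OF c3_Sym2[OF T(1)], of 3 1] Sym2D[OF c4_Sym2[OF T(1)], of 3 1] d(1) by simp_all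
  have c: "c3 T 1 3 = 0" "c4 T 1 3 = 0"
    using commutant_planar_diagonal[OF g(1) even(1) d(1) 31(1) d(2) g(2)] even(2,3) 31 g(3,4) by blast+
  define h v where "h = T 2 2 2 2" and "v = T 1 2 2 3"
  define u w y where "u = T 1 1 2 2 + h / 2" and "w = h / 8 - T 1 1 3 3" and "y = T 1 1 1 3 + v / 2"
  note E = even_d2_contr[OF T, folded h_def v_def, folded u_def w_def y_def]
  \<comment> \<open>Contraction with \<open>T\<close> annihilates the identity, and modulo the
    identity a diagonal tensor has just these two coordinates.\<close>
  define \<delta> \<alpha> where "\<delta> = (d2 T 1 1 - d2 T 3 3) / 2" and "\<alpha> = (d2 T 1 1 + d2 T 3 3) / 2 - d2 T 2 2"
  have "\<delta> \<noteq> 0" using d(2) by (simp add: \<delta>_def)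
  have e1: "- 15/4 * h * v - 2 * (y * u - w * v) = 0" using E(1) d(1) by simp
  have e2: "- v * \<alpha> + 2 * y * \<delta> = 0"
    using E(4)[of "d2 T"] c(1) ev 31 d(1) by (simp add: c3_def \<alpha>_def \<delta>_def)
  have g1: "(c3 T 1 1 - c3 T 3 3) / 2 = - u * \<alpha> + (h / 4 + 2 * w) * \<delta>"
    using E(5)[of "d2 T"] ev 31 d(1) by (simp add: c3_def \<alpha>_def \<delta>_def)
  have g0: "(c3 T 1 1 + c3 T 3 3) / 2 - c3 T 2 2 = 3/2 * h * \<alpha> - 3 * u * \<delta>"
    using E(6)[of "d2 T"] ev 31 d(1) by (simp add: c3_def \<alpha>_def \<delta>_def)
  have e3: "- v * (3/2 * h * \<alpha> - 3 * u * \<delta>) + 2 * y * (- u * \<alpha> + (h / 4 + 2 * w) * \<delta>) = 0"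
    using E(4)[of "c3 T"] ev 31 c unfolding g0 g1 by (simp add: c4_def)
  show ?thesis
  proof (cases "v = 0")
    case True
    then have "y = 0" using e2 \<open>\<delta> \<noteq> 0\<close> by simp
    then have "T 1 1 1 3 = 0" "T 1 2 2 3 = 0" using True by (simp_all add: y_def v_def)
    then show ?thesis using orthotropic_fixed[OF T] SO3_diff_Z2I(2) by blast
  next
    case False
    have "24 * w = 35 * h \<and> (6 * u = - 5 * h \<and> 2 * y = v \<or> 6 * u = 5 * h \<and> 2 * y = - v)"
      by (rule trigonal_system[OF False \<open>\<delta> \<noteq> 0\<close> _ _ e1 e2 e3]) (simp_all only: \<alpha>_def \<delta>_def E)
    then have "3 * T 1 1 3 3 = - 4 * T 2 2 2 2"
      "3 * T 1 1 2 2 = - 4 * T 2 2 2 2 \<and> T 1 1 1 3 = 0 \<or> 3 * T 1 1 2 2 = T 2 2 2 2 \<and> T 1 1 1 3 = - T 1 2 2 3"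
      by (auto simp: u_def w_def y_def h_def v_def)
    then show ?thesis
      using trigonal_fixed_1[OF T] trigonal_fixed_3[OF T] SO3_diff_Z2I(4,5) by blast
  qed
qed

text \<open>Here \<open>d2 T\<close> singles out no frame in the plane, so the frame is taken from
  the components \<open>T i j 2 2\<close>; \<open>d2\<close> keeps a zero off-diagonal entry there
  and \<open>d2_even_13\<close> decides.\<close>

lemma extra_symmetry_isotropic_plane:
  assumes T: "T \<in> H4" "act4 rot_pi_e3 T = T" and d: "d2 T 1 3 = 0" "d2 T 1 1 = d2 T 3 3"
  shows "\<exists>g\<in>SO3 - Z2. act4 g T = T"
proof -
  \<comment> \<open>The contracted tensor is the square of the axis direction 2, fixed by rotations
    about that axis; diagonalising \<open>q\<close> therefore makes \<open>S 1 2 2 3\<close>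
    vanish.\<close>
  define q where "q = contr T (\<lambda>i j. if i = 2 \<and> j = 2 then 1 else 0)"
  have q: "q i j = T i j 2 2" for i j by (simp add: q_def contr_def sum_3)
  have "q 3 1 = q 1 3" using H4D(1)[OF T(1)] by (simp add: q)
  then obtain c s where cs: "c^2 + s^2 = 1" "act2 (plane_rot c s) q 1 3 = 0"
    by (rule plane_rot_diagonalise)
  define r where "r = plane_rot c s"
  have r: "r \<in> SO3" "r ** rot_pi_e3 = rot_pi_e3 ** r"
    using cs(1) by (simp_all add: r_def plane_rot_SO3 plane_rot_commute)
  define S where "S = act4 r T"
  have S: "S \<in> H4" "act4 rot_pi_e3 S = S"
    using act4_H4[OF r(1) T(1)] T(2) by (simp_all add: S_def act4_act4 r(2)[symmetric]) (simp add: act4_act4[symmetric])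
  have "act2 r (\<lambda>i j. if i = 2 \<and> j = 2 then 1 else 0) = (\<lambda>i j. if i = 2 \<and> j = 2 then 1 else 0)"
    by (simp add: fun_eq_iff forall_3 act2_def sum_3 r_def plane_rot_def)
  then have "act2 r q = contr S (\<lambda>i j. if i = 2 \<and> j = 2 then 1 else 0)"
    using contr_act[OF r(1), of T "\<lambda>i j. if i = 2 \<and> j = 2 then 1 else 0"] by (simp add: q_def S_def)
  then have "S 1 3 2 2 = 0" using cs(2) by (simp add: contr_def sum_3 r_def)
  then have v: "S 1 2 2 3 = 0" using H4D(2,3)[OF S(1)] by metis
  have "d2 T 3 1 = 0" using Sym2D[OF d2_Sym2[OF T(1)], of 3 1] d(1) by simp
  then have "d2 S 1 3 = 0"
    using d unfolding S_def d2_act[OF r(1) T(1)] by (simp add: act2_def sum_3 r_def plane_rot_def)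
  then have "S 1 1 1 3 = 0 \<or> 2 * S 1 1 2 2 = - S 2 2 2 2"
    using d2_even_13[OF S v] by auto
  then obtain g where "g \<in> SO3 - Z2" "act4 g S = S"
    using orthotropic_fixed[OF S v] tetragonal_fixed[OF S v] SO3_diff_Z2I(1)[of 0 1] SO3_diff_Z2I(2) by auto
  then show ?thesis
    using act4_conj[OF r(1)] conj_notin_Z2(1)[OF r] unfolding S_def by blast
qed

lemma extra_symmetry_even:
  assumes T: "T \<in> H4" "act4 rot_pi_e3 T = T"
    and g: "g \<in> SO3 - Z2" "act2 g (d2 T) = d2 T" "act2 g (c3 T) = c3 T" "act2 g (c4 T) = c4 T"
  shows "\<exists>g\<in>SO3 - Z2. act4 g T = T"
proof -
  have "d2 T 3 1 = d2 T 1 3" using Sym2D[OF d2_Sym2[OF T(1)]] .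
  then obtain c s where cs: "c^2 + s^2 = 1" "act2 (plane_rot c s) (d2 T) 1 3 = 0"
    by (rule plane_rot_diagonalise)
  define r where "r = plane_rot c s"
  have r: "r \<in> SO3" "r ** rot_pi_e3 = rot_pi_e3 ** r"
    using cs(1) by (simp_all add: r_def plane_rot_SO3 plane_rot_commute)
  define S where "S = act4 r T"
  have S: "S \<in> H4" "act4 rot_pi_e3 S = S"
    using act4_H4[OF r(1) T(1)] T(2) by (simp_all add: S_def act4_act4 r(2)[symmetric]) (simp add: act4_act4[symmetric])
  have d: "d2 S 1 3 = 0" using cs(2) unfolding S_def d2_act[OF r(1) T(1)] by (simp add: r_def)
  have "\<exists>g\<in>SO3 - Z2. act4 g S = S"
  proof (cases "d2 S 1 1 = d2 S 3 3")
    case True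
    then show ?thesis using extra_symmetry_isotropic_plane[OF S d] by simp
  next
    case False
    show ?thesis
      by (rule extra_symmetry_diagonal_frame[OF S conj_notin_Z2(2)[OF r g(1)] _ _ _ d False])
        (simp_all add: S_def d2_act c3_act c4_act r(1) T(1) act2_conj g)
  qed
  then show ?thesis
    using act4_conj[OF r(1)] conj_notin_Z2(1)[OF r] unfolding S_def by blast
qed

section \<open>Tensors with a nonzero odd part\<close>

text \<open>Tracelessness allows \<open>a 2 2\<close> times the identity to be subtracted from
  \<open>a\<close>, which leaves a planar form.\<close>

lemma contr_planar:
  assumes T: "T \<in> H4" and a: "a \<in> Sym2" "act2 rot_pi_e3 a = a"
  shows "contr T a i j = T i j 1 1 * (a 1 1 - a 2 2) + 2 * T i j 1 3 * a 1 3 + T i j 3 3 * (a 3 3 - a 2 2)"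
proof -
  have "(\<Sum>k\<in>UNIV. T i j k k) = 0"
  proof -
    note sym = H4D(1-3)[OF T]
    have "T i j k k = T k k i j" for k
      using sym(2)[of i j k k] sym(1)[of i k j k] sym(3)[of k i j k] sym(2)[of k i k j] by simp
    then show ?thesis using H4D(4)[OF T, of i j] by simp
  qed
  then have "T i j 2 2 = - T i j 1 1 - T i j 3 3" by (simp add: sum_3)
  moreover have "T i j 3 1 = T i j 1 3" "a 3 1 = a 1 3" using H4D(3)[OF T] Sym2D[OF a(1)] by metis+
  moreover note a(2)[unfolded rot_pi_fixes2_iff]
  ultimately show ?thesis by (simp add: contr_def sum_3) (simp add: algebra_simps)
qed

text \<open>The flip axis is a principal axis of the planar block. The condition on \<open>c\<close>
  and \<open>s\<close> is linear in \<open>a\<close> and blind to multiples of the identity, so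
  tensors proportional modulo the identity share a flip.\<close>

lemma plane_flip_fixes:
  assumes a: "a \<in> Sym2" "act2 rot_pi_e3 a = a" and cs: "c^2 + s^2 = 1" "s * (a 1 1 - a 3 3) = c * (2 * a 1 3)"
  shows "act2 (plane_flip c s) a = a"
proof -
  have 31: "a 3 1 = a 1 3" using Sym2D[OF a(1)] .
  note e = a(2)[unfolded rot_pi_fixes2_iff]
  have "act2 (plane_flip c s) a 1 1 = (c^2 + s^2) * a 1 1 - s * (s * (a 1 1 - a 3 3) - c * (2 * a 1 3))"
    "act2 (plane_flip c s) a 3 3 = (c^2 + s^2) * a 3 3 + s * (s * (a 1 1 - a 3 3) - c * (2 * a 1 3))"
    "act2 (plane_flip c s) a 1 3 = (c^2 + s^2) * a 1 3 + c * (s * (a 1 1 - a 3 3) - c * (2 * a 1 3))"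
    using 31 e by (simp_all add: act2_def sum_3 plane_flip_def algebra_simps power2_eq_square)
  then have "act2 (plane_flip c s) a 1 1 = a 1 1" "act2 (plane_flip c s) a 3 3 = a 3 3"
    "act2 (plane_flip c s) a 1 3 = a 1 3"
    using cs by simp_all
  moreover have "act2 (plane_flip c s) a 3 1 = act2 (plane_flip c s) a 1 3"
    using 31 by (simp add: act2_def sum_3 plane_flip_def algebra_simps)
  moreover have "act2 (plane_flip c s) a 2 2 = a 2 2" "act2 (plane_flip c s) a 1 2 = a 1 2" "act2 (plane_flip c s) a 2 1 = a 2 1"
      "act2 (plane_flip c s) a 2 3 = a 2 3" "act2 (plane_flip c s) a 3 2 = a 3 2"
    using e by (simp_all add: act2_def sum_3 plane_flip_def)
  ultimately show ?thesis by (simp add: fun_eq_iff forall_3 31)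
qed

text \<open>The \<open>n1\<close>, \<open>n2\<close>, \<open>n3\<close> form the cross product of
  the two coefficient rows.\<close>

lemma parallel_of_orthogonal:
  fixes x1 x2 x3 :: real
  assumes "p1 * x1 + p2 * x2 + p3 * x3 = 0" "q1 * x1 + q2 * x2 + q3 * x3 = 0"
    and n: "n1 = p2 * q3 - p3 * q2" "n2 = p3 * q1 - p1 * q3" "n3 = p1 * q2 - p2 * q1"
    and "\<not> (n1 = 0 \<and> n2 = 0 \<and> n3 = 0)"
  obtains \<beta> where "x1 = \<beta> * n1" "x2 = \<beta> * n2" "x3 = \<beta> * n3"
proof -
  have "n1 * x2 - n2 * x1 = q3 * (p1 * x1 + p2 * x2 + p3 * x3) - p3 * (q1 * x1 + q2 * x2 + q3 * x3)"
    "n2 * x3 - n3 * x2 = q1 * (p1 * x1 + p2 * x2 + p3 * x3) - p1 * (q1 * x1 + q2 * x2 + q3 * x3)"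
    "n3 * x1 - n1 * x3 = q2 * (p1 * x1 + p2 * x2 + p3 * x3) - p2 * (q1 * x1 + q2 * x2 + q3 * x3)"
    unfolding n by (simp_all add: algebra_simps)
  then have c: "n1 * x2 = n2 * x1" "n2 * x3 = n3 * x2" "n3 * x1 = n1 * x3" using assms(1,2) by simp_all
  consider "n1 \<noteq> 0" | "n2 \<noteq> 0" | "n3 \<noteq> 0" using assms(6) by blast
  then show ?thesis
  proof cases
    case 1 then show ?thesis using that[of "x1 / n1"] c by (simp add: field_simps)
  next
    case 2 then show ?thesis using that[of "x2 / n2"] c by (simp add: field_simps)
  next
    case 3 then show ?thesis using that[of "x3 / n3"] c by (simp add: field_simps)
  qed
qed

text \<open>The odd part of \<open>T\<close> is the binary cubic \<open>T\<^sub>2\<^sub>a\<^sub>b\<^sub>c\<close> on the plane of the axes 1 and 3. The assumption says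
  that it is not a cube of a linear form, so that contraction with planar quadratic forms
  has rank 2. Its kernel is then a line, and everything in it commutes.\<close>

lemma odd_nondegenerate:
  assumes T: "T \<in> H4"
    and n: "\<not> (T 1 1 2 3 * T 2 3 3 3 = (T 1 2 3 3)^2 \<and> T 1 1 2 3 * T 1 2 3 3 = T 1 1 1 2 * T 2 3 3 3
        \<and> T 1 1 1 2 * T 1 2 3 3 = (T 1 1 2 3)^2)"
    and R: "act2 rot_pi_e3 (d2 T) = d2 T" "act2 rot_pi_e3 (c3 T) = c3 T" "act2 rot_pi_e3 (c4 T) = c4 T"
  shows "\<exists>g\<in>SO3 - Z2. act2 g (c4 T) = c4 T \<and>
    (\<forall>a\<in>Sym2. act2 rot_pi_e3 a = a \<and> act2 rot_pi_e3 (contr T a) = contr T a \<longrightarrow> act2 g a = a)"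
proof -
  \<comment> \<open>Cross product of the rows through which \<open>contr T a 1 2\<close> and
    \<open>contr T a 2 3\<close> depend on the planar form of \<open>a\<close>.\<close>
  define n1 n2 n3 where "n1 = 2 * (T 1 1 2 3 * T 2 3 3 3 - (T 1 2 3 3)^2)"
    and "n2 = T 1 1 2 3 * T 1 2 3 3 - T 1 1 1 2 * T 2 3 3 3"
    and "n3 = 2 * (T 1 1 1 2 * T 1 2 3 3 - (T 1 1 2 3)^2)"
  have nz: "\<not> (n1 = 0 \<and> n2 = 0 \<and> n3 = 0)" using n by (simp add: n1_def n2_def n3_def)
  note sym = H4D(1-3)[OF T]
  have par: "\<exists>\<beta>. a 1 1 - a 2 2 = \<beta> * n1 \<and> a 1 3 = \<beta> * n2 \<and> a 3 3 - a 2 2 = \<beta> * n3"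
    if a: "a \<in> Sym2" "act2 rot_pi_e3 a = a" "act2 rot_pi_e3 (contr T a) = contr T a" for a
  proof -
    have "contr T a 1 2 = 0" "contr T a 2 3 = 0" using a(3) by (simp_all add: rot_pi_fixes2_iff)
    then have "T 1 1 1 2 * (a 1 1 - a 2 2) + (2 * T 1 1 2 3) * a 1 3 + T 1 2 3 3 * (a 3 3 - a 2 2) = 0"
      "T 1 1 2 3 * (a 1 1 - a 2 2) + (2 * T 1 2 3 3) * a 1 3 + T 2 3 3 3 * (a 3 3 - a 2 2) = 0"
      using contr_planar[OF T a(1,2), of 1 2] contr_planar[OF T a(1,2), of 2 3] by (simp_all add: sym)
    moreover have "n1 = 2 * T 1 1 2 3 * T 2 3 3 3 - T 1 2 3 3 * (2 * T 1 2 3 3)"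
      "n2 = T 1 2 3 3 * T 1 1 2 3 - T 1 1 1 2 * T 2 3 3 3"
      "n3 = T 1 1 1 2 * (2 * T 1 2 3 3) - 2 * T 1 1 2 3 * T 1 1 2 3"
      by (simp_all add: n1_def n2_def n3_def power2_eq_square algebra_simps)
    ultimately show ?thesis
      using parallel_of_orthogonal[OF _ _ _ _ _ nz] by metis
  qed
  obtain c s where cs: "c^2 + s^2 = 1" "s * (n1 - n3) = c * (2 * n2)" by (rule planar_angle)
  define g where "g = plane_flip c s"
  have flip: "act2 g a = a"
    if a: "a \<in> Sym2" "act2 rot_pi_e3 a = a" "act2 rot_pi_e3 (contr T a) = contr T a" for a
  proof -
    obtain \<beta> where b: "a 1 1 - a 2 2 = \<beta> * n1" "a 1 3 = \<beta> * n2" "a 3 3 - a 2 2 = \<beta> * n3"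
      using par[OF a] by blast
    then have "a 1 1 - a 3 3 = \<beta> * (n1 - n3)" by (simp add: algebra_simps)
    then have "s * (a 1 1 - a 3 3) = \<beta> * (s * (n1 - n3))" by simp
    also have "\<dots> = c * (2 * a 1 3)" unfolding cs(2) b(2) by simp
    finally show ?thesis unfolding g_def using plane_flip_fixes[OF a(1,2) cs(1)] by blast
  qed
  define N where "N i j = T i j 1 1 * n1 + 2 * T i j 1 3 * n2 + T i j 3 3 * n3" for i j
  have scale: "\<exists>\<beta>. contr T a = (\<lambda>i j. \<beta> * N i j)"
    if a: "a \<in> Sym2" "act2 rot_pi_e3 a = a" "act2 rot_pi_e3 (contr T a) = contr T a" for a
  proof -
    obtain \<beta> where "a 1 1 - a 2 2 = \<beta> * n1" "a 1 3 = \<beta> * n2" "a 3 3 - a 2 2 = \<beta> * n3"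
      using par[OF a] by blast
    then have "contr T a i j = \<beta> * N i j" for i j
      unfolding contr_planar[OF T a(1,2)] N_def by (simp add: algebra_simps)
    then show ?thesis by blast
  qed
  obtain \<beta> \<gamma> where c34: "c3 T = (\<lambda>i j. \<beta> * N i j)" "c4 T = (\<lambda>i j. \<gamma> * N i j)"
    using scale[OF d2_Sym2[OF T] R(1)] scale[OF c3_Sym2[OF T] R(2)] R(2,3)
    unfolding c3_def[symmetric] c4_def[symmetric] by blast
  \<comment> \<open>\<open>flip\<close> does not reach \<open>c4 T\<close>, about whose own
    contraction nothing is assumed. But \<open>c3 T\<close> and \<open>c4 T\<close> are multiples of
    the same \<open>N\<close>, and \<open>c4 T\<close> vanishes with \<open>c3 T\<close>.\<close>
  have "act2 g (c4 T) = c4 T"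
  proof (cases "\<beta> = 0")
    case True
    then have "c4 T = (\<lambda>i j. 0)" using c34(1) by (simp add: c4_def contr_def)
    then show ?thesis by (simp add: act2_def)
  next
    case False
    have "act2 g (c3 T) = c3 T"
      using flip[OF c3_Sym2[OF T] R(2)] R(3) by (simp add: c4_def)
    then have "\<beta> * act2 g N i j = \<beta> * N i j" for i j
      unfolding c34(1) by (metis act2_scale)
    then have "act2 g N i j = N i j" for i j using False by simp
    then show ?thesis unfolding c34(2) by (simp add: fun_eq_iff act2_scale)
  qed
  moreover have "g \<in> SO3 - Z2"
    using plane_flip_SO3[OF cs(1)] plane_flip_notin_Z2 by (simp add: g_def)
  ultimately show ?thesis using flip by blast
qed

text \<open>The odd part is a multiple of the cube of the first coordinate. The vanishing mixed
  entries of \<open>d2\<close> and \<open>c3\<close> then leave no component with an odd number of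
  indices 3.\<close>

lemma odd_degenerate_frame:
  assumes T: "T \<in> H4"
    and t: "T 1 1 1 2 \<noteq> 0" "T 1 1 2 3 = 0" "T 1 2 3 3 = 0" "T 2 3 3 3 = 0"
    and R: "act2 rot_pi_e3 (d2 T) = d2 T" "act2 rot_pi_e3 (c3 T) = c3 T"
  shows "act4 (diag3 (-1) (-1) 1) T = T"
proof -
  note sym = H4D(1-3)[OF T]
  note tr = H4_trace[OF T]
  have "T 1 1 1 2 * (T 1 1 1 1 - T 2 2 2 2) = d2 T 1 2"
    by (simp add: d2_alt[OF T] sum_3 sym tr t algebra_simps)
  then have p: "T 1 1 1 1 = T 2 2 2 2" using R(1) t(1) by (simp add: rot_pi_fixes2_iff)
  have "T 1 1 1 2 * (T 1 1 1 3 - 3 * T 1 2 2 3) = d2 T 2 3"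
    by (simp add: d2_alt[OF T] sum_3 sym tr t algebra_simps)
  then have b: "T 1 1 1 3 = 3 * T 1 2 2 3" using R(1) t(1) by (simp add: rot_pi_fixes2_iff)
  have "T 1 1 1 2 * (d2 T 1 1 - d2 T 2 2) = c3 T 1 2"
    unfolding c3_def contr_planar[OF T d2_Sym2[OF T] R(1)] using t by (simp add: sym)
  then have "d2 T 1 1 = d2 T 2 2" using R(2) t(1) by (simp add: rot_pi_fixes2_iff)
  moreover have p': "T 1 1 3 3 = - T 1 1 2 2 - T 2 2 2 2" using p tr(2) by simp
  \<comment> \<open>After insertion of the linear relations the difference is a multiple of a real
    square, so its vanishing forces \<open>T 1 2 2 3 = 0\<close>.\<close>
  have "d2 T 1 1 - d2 T 2 2 = 40 * (T 1 2 2 3)^2"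
    by (simp add: d2_alt[OF T] sum_3 sym tr t b p') (simp add: algebra_simps power2_eq_square)
  ultimately have b0: "T 1 2 2 3 = 0" by simp
  have "act4 (diag3 (-1) (-1) 1) T i j k l =
    (if i = 3 then 1 else - 1) * (if j = 3 then 1 else - 1) * (if k = 3 then 1 else - 1) * (if l = 3 then 1 else - 1) * T i j k l"
    for i j k l
  proof (rule act4_diag)
    fix i j :: 3
    show "diag3 (-1) (-1) 1 $ i $ j = (if i = j then if i = 3 then 1 else -1 else 0)"
      using exhaust_3[of i] by auto
  qed
  then show ?thesis
    by (intro H4_eqI act4_H4 diag3_SO3 T) (use t b b0 in simp_all)
qed

lemma odd_degenerate:
  assumes T: "T \<in> H4" "act4 rot_pi_e3 T \<noteq> T"
    and n: "T 1 1 2 3 * T 2 3 3 3 = (T 1 2 3 3)^2" "T 1 1 2 3 * T 1 2 3 3 = T 1 1 1 2 * T 2 3 3 3"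
        "T 1 1 1 2 * T 1 2 3 3 = (T 1 1 2 3)^2"
    and R: "act2 rot_pi_e3 (d2 T) = d2 T" "act2 rot_pi_e3 (c3 T) = c3 T"
  shows "\<exists>g\<in>SO3 - Z2. act4 g T = T"
proof -
  \<comment> \<open>The vanishing minors make the cubic depend on the direction
    \<open>(c, s)\<close> only. If \<open>T 1 1 1 2 = 0\<close>, just \<open>T 2 3 3 3\<close> can
    be nonzero and the direction is \<open>(0, 1)\<close>.\<close>
  obtain c s where cs: "c^2 + s^2 = 1" and
    ker: "c * T 1 1 2 3 - s * T 1 1 1 2 = 0" "c * T 1 2 3 3 - s * T 1 1 2 3 = 0" "c * T 2 3 3 3 - s * T 1 2 3 3 = 0"
  proof (cases "T 1 1 1 2 = 0")
    case True
    then show ?thesis using that[of 0 1] n by simp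
  next
    case False
    obtain c s where cs: "c^2 + s^2 = 1" "s * T 1 1 1 2 = c * T 1 1 2 3" by (rule planar_angle)
    have "T 1 1 1 2 * (c * T 1 2 3 3 - s * T 1 1 2 3) = c * (T 1 1 2 3)^2 - (s * T 1 1 1 2) * T 1 1 2 3"
      "T 1 1 1 2 * (c * T 2 3 3 3 - s * T 1 2 3 3) = c * (T 1 1 2 3 * T 1 2 3 3) - (s * T 1 1 1 2) * T 1 2 3 3"
      unfolding n(2) n(3)[symmetric] by (simp_all add: algebra_simps)
    then show ?thesis using that[OF cs(1)] cs(2) False by (simp add: power2_eq_square)
  qed
  define r where "r = plane_rot c s"
  have r: "r \<in> SO3" "r ** rot_pi_e3 = rot_pi_e3 ** r"
    using cs by (simp_all add: r_def plane_rot_SO3 plane_rot_commute)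
  define S where "S = act4 r T"
  have S: "S \<in> H4" using act4_H4[OF r(1) T(1)] by (simp add: S_def)
  note sym = H4D(1-3)[OF T(1)]
  \<comment> \<open>Components of the cubic with one argument set to \<open>(-s, c)\<close>, the
    third row of \<open>r\<close> in the plane; that direction lies in the kernel, so all three
    vanish.\<close>
  define A B C where "A = c * T 1 1 2 3 - s * T 1 1 1 2" and "B = c * T 1 2 3 3 - s * T 1 1 2 3"
    and "C = c * T 2 3 3 3 - s * T 1 2 3 3"
  have "S 1 1 2 3 = c * c * A + 2 * c * s * B + s * s * C"
    "S 1 2 3 3 = - c * s * A + (c * c - s * s) * B + s * c * C"
    "S 2 3 3 3 = s * s * A - 2 * s * c * B + c * c * C"
    by (simp_all add: S_def A_def B_def C_def r_def plane_rot_def act4_def sum_3 sym algebra_simps)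
  then have t: "S 1 1 2 3 = 0" "S 1 2 3 3 = 0" "S 2 3 3 3 = 0"
    using ker by (simp_all add: A_def B_def C_def)
  have "act4 rot_pi_e3 S \<noteq> S"
  proof
    assume "act4 rot_pi_e3 S = S"
    then have "act4 (transpose r ** rot_pi_e3 ** r) T = T" using act4_conj[OF r(1)] by (simp add: S_def)
    moreover have "transpose r ** rot_pi_e3 ** r = rot_pi_e3"
      using r(2) SO3_transpose_mult(1)[OF r(1)] by (metis matrix_mul_assoc matrix_mul_lid)
    ultimately show False using T(2) by simp
  qed
  then have t0: "S 1 1 1 2 \<noteq> 0" using t rot_pi_fixes4_iff[OF S] by blast
  have "act2 rot_pi_e3 (act2 r a) = act2 r a" if "act2 rot_pi_e3 a = a" for a
    using that by (simp add: act2_act2 r(2)[symmetric]) (simp add: act2_act2[symmetric])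
  then have "act2 rot_pi_e3 (d2 S) = d2 S" "act2 rot_pi_e3 (c3 S) = c3 S"
    using R unfolding S_def d2_act[OF r(1) T(1)] c3_act[OF r(1) T(1)] by blast+
  then have "act4 (diag3 (-1) (-1) 1) S = S" using odd_degenerate_frame[OF S t0 t] by blast
  then show ?thesis
    using act4_conj[OF r(1)] conj_notin_Z2(1)[OF r SO3_diff_Z2I(3)] unfolding S_def by blast
qed

section \<open>Symmetry groups\<close>

lemma symgrp_chain:
  assumes "H \<in> H4"
  shows "symgrp4 H \<subseteq> symgrp2_set (Cov2 H)" "symgrp2_set (Cov2 H) \<subseteq> symgrp2_set {d2 H, c3 H, c4 H}"
proof -
  show "symgrp4 H \<subseteq> symgrp2_set (Cov2 H)"
  proof
    fix g assume "g \<in> symgrp4 H"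
    then have g: "g \<in> SO3" "act4 g H = H" by (auto simp: symgrp4_def)
    have "act2 g (F H) = F H" if "equiv_poly_map F" for F
      using that g assms unfolding equiv_poly_map_def by metis
    then show "g \<in> symgrp2_set (Cov2 H)" using g(1) by (auto simp: symgrp2_set_def Cov2_def)
  qed
  have "c3 H \<in> Cov2 H" "c4 H \<in> Cov2 H"
    by (simp_all add: c3_def c4_def Cov2_contr d2_Cov2)
  then show "symgrp2_set (Cov2 H) \<subseteq> symgrp2_set {d2 H, c3 H, c4 H}"
    using d2_Cov2 by (auto simp: symgrp2_set_def)
qed

lemma Z2_subset_symgrp4: "act4 rot_pi_e3 H = H \<Longrightarrow> Z2 \<subseteq> symgrp4 H"
  using rot_pi_SO3 by (auto simp: Z2_def symgrp4_def SO3_def orthogonal_matrix_id)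

text \<open>The theorem in the frame where the group is \<open>Z2\<close> itself; conjugation
  supplies the general case.\<close>

lemma symgrp_Z2:
  assumes H: "H \<in> H4"
  shows "symgrp4 H = Z2 \<longleftrightarrow> symgrp2_set (Cov2 H) = Z2"
    and "symgrp2_set {d2 H, c3 H, c4 H} = Z2 \<longleftrightarrow> symgrp4 H = Z2"
proof -
  note chain = symgrp_chain[OF H]
  have 1: "symgrp2_set {d2 H, c3 H, c4 H} = Z2" if Z: "symgrp4 H = Z2"
  proof -
    have "act4 rot_pi_e3 H = H" using Z by (auto simp: symgrp4_def Z2_def)
    then have "g \<in> Z2" if "g \<in> symgrp2_set {d2 H, c3 H, c4 H}" for g
      using extra_symmetry_even[OF H, of g] that Z by (auto simp: symgrp2_set_def symgrp4_def)
    then show ?thesis using Z chain by blast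
  qed
  \<comment> \<open>\<open>S\<close> stands for the group of \<open>Cov2 H\<close> or of the triple,
    and \<open>cov\<close> accepts exactly what \<open>odd_nondegenerate\<close> supplies, so one
    argument serves both.\<close>
  have 2: "symgrp4 H = Z2" if S: "S = Z2" "symgrp4 H \<subseteq> S" "S \<subseteq> symgrp2_set {d2 H, c3 H, c4 H}"
    and cov: "\<And>g. g \<in> SO3 \<Longrightarrow> act2 g (c4 H) = c4 H \<Longrightarrow>
      (\<forall>a\<in>Sym2. act2 rot_pi_e3 a = a \<and> act2 rot_pi_e3 (contr H a) = contr H a \<longrightarrow> act2 g a = a) \<Longrightarrow> g \<in> S" for S
  proof -
    have R: "act2 rot_pi_e3 (d2 H) = d2 H" "act2 rot_pi_e3 (c3 H) = c3 H" "act2 rot_pi_e3 (c4 H) = c4 H"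
      using S(1,3) by (auto simp: symgrp2_set_def Z2_def)
    have "act4 rot_pi_e3 H = H"
    proof (rule ccontr)
      assume ne: "act4 rot_pi_e3 H \<noteq> H"
      have "\<exists>g\<in>SO3 - Z2. g \<in> S"
        using odd_degenerate[OF H ne _ _ _ R(1,2)] odd_nondegenerate[OF H _ R] S(2) cov
        by (auto simp: symgrp4_def)
      then show False using S(1) by blast
    qed
    then show ?thesis using Z2_subset_symgrp4 S by blast
  qed
  have R3: "act2 g (d2 H) = d2 H" "act2 g (c3 H) = c3 H"
    if "\<forall>a\<in>Sym2. act2 rot_pi_e3 a = a \<and> act2 rot_pi_e3 (contr H a) = contr H a \<longrightarrow> act2 g a = a"
      "act2 rot_pi_e3 (d2 H) = d2 H" "act2 rot_pi_e3 (c3 H) = c3 H" "act2 rot_pi_e3 (c4 H) = c4 H" for g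
    using that d2_Sym2[OF H] c3_Sym2[OF H] by (auto simp: c3_def c4_def)
  have R2: "act2 rot_pi_e3 a = a" if "symgrp2_set A = Z2" "a \<in> A" for a A
    using that by (auto simp: symgrp2_set_def Z2_def)
  have 3: "symgrp4 H = Z2" if Z: "symgrp2_set {d2 H, c3 H, c4 H} = Z2"
  proof (rule 2[OF Z])
    show "symgrp4 H \<subseteq> symgrp2_set {d2 H, c3 H, c4 H}" using chain by blast
    fix g assume g: "g \<in> SO3" "act2 g (c4 H) = c4 H"
      "\<forall>a\<in>Sym2. act2 rot_pi_e3 a = a \<and> act2 rot_pi_e3 (contr H a) = contr H a \<longrightarrow> act2 g a = a"
    then show "g \<in> symgrp2_set {d2 H, c3 H, c4 H}"
      using R3[of g] R2[OF Z] by (simp add: symgrp2_set_def)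
  qed simp
  have 4: "symgrp4 H = Z2" if Z: "symgrp2_set (Cov2 H) = Z2"
  proof (rule 2[OF Z chain])
    fix g assume g: "g \<in> SO3" "act2 g (c4 H) = c4 H"
      "\<forall>a\<in>Sym2. act2 rot_pi_e3 a = a \<and> act2 rot_pi_e3 (contr H a) = contr H a \<longrightarrow> act2 g a = a"
    \<comment> \<open>Closure of \<open>Cov2 H\<close> under contraction makes
      \<open>contr H a\<close> fixed by the half turn along with \<open>a\<close>.\<close>
    then have "act2 g a = a" if "a \<in> Cov2 H" for a
      using Cov2_Sym2[OF H] Cov2_contr[OF that] that R2[OF Z] by blast
    then show "g \<in> symgrp2_set (Cov2 H)" using g(1) by (simp add: symgrp2_set_def)
  qed
  show "symgrp4 H = Z2 \<longleftrightarrow> symgrp2_set (Cov2 H) = Z2"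
    using 1 4 chain by blast
  show "symgrp2_set {d2 H, c3 H, c4 H} = Z2 \<longleftrightarrow> symgrp4 H = Z2"
    using 1 3 by blast
qed

section \<open>Conjugate groups and rotated tensors\<close>

abbreviation conj3 :: "mat3 \<Rightarrow> mat3 \<Rightarrow> mat3" where
  "conj3 g k \<equiv> g ** k ** transpose g"

lemma conj3_inverse:
  assumes "g \<in> SO3"
  shows "conj3 (transpose g) (conj3 g k) = k" "conj3 g (conj3 (transpose g) k) = k"
proof -
  note inv = SO3_transpose_mult[OF assms]
  have "conj3 (transpose g) (conj3 g k) = (transpose g ** g) ** k ** (transpose g ** g)"
    "conj3 g (conj3 (transpose g) k) = (g ** transpose g) ** k ** (g ** transpose g)"
    by (simp_all only: matrix_mul_assoc transpose_transpose)
  then show "conj3 (transpose g) (conj3 g k) = k" "conj3 g (conj3 (transpose g) k) = k"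
    by (simp_all only: inv matrix_mul_lid matrix_mul_rid)
qed

lemma conj3_image_eq_iff:
  assumes "g \<in> SO3"
  shows "A = conj3 g ` B \<longleftrightarrow> conj3 (transpose g) ` A = B"
  using conj3_inverse[OF assms] by (auto simp: image_image)

text \<open>With the conjugation moved to the side of \<open>G\<close>, it can be read as the
  symmetry group of a rotated tensor.\<close>

lemma monoclinic_iff_conj: "monoclinic G \<longleftrightarrow> (\<exists>g\<in>SO3. conj3 g ` G = Z2)"
proof -
  have "monoclinic G \<longleftrightarrow> (\<exists>g\<in>SO3. conj3 (transpose g) ` G = Z2)"
    unfolding monoclinic_def by (intro bex_cong refl) (simp only: SO3_matrix_inv conj3_image_eq_iff)
  also have "\<dots> \<longleftrightarrow> (\<exists>g\<in>SO3. conj3 g ` G = Z2)"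
    by (metis SO3_transpose transpose_transpose)
  finally show ?thesis .
qed

lemma symgrp4_act:
  assumes g: "g \<in> SO3"
  shows "symgrp4 (act4 g H) = conj3 g ` symgrp4 H"
proof -
  have sub: "conj3 g ` symgrp4 H \<subseteq> symgrp4 (act4 g H)" if g: "g \<in> SO3" for g H
  proof
    fix x assume "x \<in> conj3 g ` symgrp4 H"
    then obtain k where k: "k \<in> SO3" "act4 k H = H" "x = conj3 g k" by (auto simp: symgrp4_def)
    have "act4 k (act4 (transpose g) (act4 g H)) = act4 (transpose g) (act4 g H)"
      using k(2) by (simp add: act4_act4[of "transpose g"] SO3_transpose_mult[OF g])
    then have "act4 x (act4 g H) = act4 g H"
      using act4_conj[OF SO3_transpose[OF g]] k(3) by simp
    then show "x \<in> symgrp4 (act4 g H)"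
      using k(1,3) g by (simp add: symgrp4_def SO3_mult SO3_transpose)
  qed
  have "conj3 (transpose g) ` symgrp4 (act4 g H) \<subseteq> symgrp4 H"
    using sub[OF SO3_transpose[OF g], of "act4 g H"] by (simp add: act4_act4 SO3_transpose_mult[OF g])
  then have "conj3 g ` conj3 (transpose g) ` symgrp4 (act4 g H) \<subseteq> conj3 g ` symgrp4 H"
    by (rule image_mono)
  then have "symgrp4 (act4 g H) \<subseteq> conj3 g ` symgrp4 H"
    unfolding image_image conj3_inverse(2)[OF g] by simp
  with sub[OF g] show ?thesis by blast
qed

lemma symgrp2_set_act:
  assumes g: "g \<in> SO3"
  shows "symgrp2_set (act2 g ` S) = conj3 g ` symgrp2_set S"
proof -
  have sub: "conj3 g ` symgrp2_set S \<subseteq> symgrp2_set (act2 g ` S)" if "g \<in> SO3" for g S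
    using that act2_conj[OF that] by (auto simp: symgrp2_set_def SO3_mult SO3_transpose)
  have "conj3 (transpose g) ` symgrp2_set (act2 g ` S) \<subseteq> symgrp2_set S"
    using sub[OF SO3_transpose[OF g], of "act2 g ` S"]
    by (simp add: image_image act2_act2 SO3_transpose_mult[OF g])
  then have "conj3 g ` conj3 (transpose g) ` symgrp2_set (act2 g ` S) \<subseteq> conj3 g ` symgrp2_set S"
    by (rule image_mono)
  then have "symgrp2_set (act2 g ` S) \<subseteq> conj3 g ` symgrp2_set S"
    unfolding image_image conj3_inverse(2)[OF g] by simp
  with sub[OF g] show ?thesis by blast
qed

theorem theorem9p15:
  fixes H :: tens4
  assumes "H \<in> H4"
  shows "(monoclinic (symgrp4 H) \<longleftrightarrow> monoclinic (symgrp2_set (Cov2 H)))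
       \<and> (monoclinic (symgrp2_set (Cov2 H)) \<longleftrightarrow> monoclinic (symgrp2_set {d2 H, c3 H, c4 H}))
       \<and> (monoclinic (symgrp4 H) \<longrightarrow> symgrp4 H = symgrp2_set {d2 H, c3 H, c4 H})"
proof -
  \<comment> \<open>This is \<open>symgrp_Z2\<close> for the tensor rotated by \<open>g\<close>; the
    same \<open>g\<close> serves all three groups.\<close>
  have iff: "conj3 g ` symgrp4 H = Z2 \<longleftrightarrow> conj3 g ` symgrp2_set (Cov2 H) = Z2"
      "conj3 g ` symgrp2_set {d2 H, c3 H, c4 H} = Z2 \<longleftrightarrow> conj3 g ` symgrp4 H = Z2"
    if g: "g \<in> SO3" for g
  proof -
    have "{d2 (act4 g H), c3 (act4 g H), c4 (act4 g H)} = act2 g ` {d2 H, c3 H, c4 H}"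
      by (simp add: d2_act c3_act c4_act g assms)
    with symgrp_Z2[OF act4_H4[OF g assms]]
    show "conj3 g ` symgrp4 H = Z2 \<longleftrightarrow> conj3 g ` symgrp2_set (Cov2 H) = Z2"
      "conj3 g ` symgrp2_set {d2 H, c3 H, c4 H} = Z2 \<longleftrightarrow> conj3 g ` symgrp4 H = Z2"
      unfolding Cov2_act[OF g assms] symgrp4_act[OF g] symgrp2_set_act[OF g, symmetric] by simp_all
  qed
  have "symgrp4 H = symgrp2_set {d2 H, c3 H, c4 H}" if mono: "monoclinic (symgrp4 H)"
  proof -
    obtain g where g: "g \<in> SO3" "conj3 g ` symgrp4 H = Z2"
      using mono unfolding monoclinic_iff_conj by blast
    then have "conj3 g ` symgrp4 H = conj3 g ` symgrp2_set {d2 H, c3 H, c4 H}"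
      using iff(2)[OF g(1)] by simp
    \<comment> \<open>One conjugation sends both groups to \<open>Z2\<close>, so they are equal and
      not merely conjugate.\<close>
    moreover have "inj (conj3 g)"
      by (rule inj_on_inverseI) (rule conj3_inverse(1)[OF g(1)])
    ultimately show ?thesis by (simp add: inj_image_eq_iff)
  qed
  then show ?thesis
    using iff by (auto simp: monoclinic_iff_conj)
qed

end
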